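(* For any positive integer $v=12u+1$ with $u\equiv 2,3\pmod 4$ and $u\geq 7$, $J_{3}[v]=I_{3}[v]$.
   Context: An $S(2,4,v)$ design is a pair $(\mathcal{V},\mathcal{B})$ with $|\mathcal{V}|=v$ and $\mathcal{B}$ a family of 4-subsets (blocks) of $\mathcal{V}$ such that each 2-subset of $\mathcal{V}$ lies in exactly one block; it has $b_v=\frac{v(v-1)}{12}$ blocks. For integers $a\le b$, $[a,b]=\{a,\dots,b\}$, and $I_{3}[v]=[0,b_{v}]\setminus[b_{v}-7,b_{v}-1]$. $J_{3}[v]$ is the set of integers $k$ for which there exist three $S(2,4,v)$ designs on a common point set with block sets $\mathcal{B}_1,\mathcal{B}_2,\mathcal{B}_3$ such that $\mathcal{B}_1\cap\mathcal{B}_2=\mathcal{B}_1\cap\mathcal{B}_3=\mathcal{B}_2\cap\mathcal{B}_3$ and this common set has exactly $k$ blocks. *)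

theory Defs
  imports Main "HOL-Number_Theory.Cong"
begin

definition S24_design :: "nat \<Rightarrow> 'a set \<Rightarrow> 'a set set \<Rightarrow> bool" where
  "S24_design v V B \<longleftrightarrow>
     finite V \<and> card V = v \<and>
     (\<forall>b\<in>B. b \<subseteq> V \<and> card b = 4) \<and>
     (\<forall>e. e \<subseteq> V \<and> card e = 2 \<longrightarrow> (\<exists>!b. b \<in> B \<and> e \<subseteq> b))"

(* The division is exact whenever an S(2,4,v) design exists (v = 1 or 4 mod 12). *)
definition block_number :: "nat \<Rightarrow> int" where
  "block_number v = int v * (int v - 1) div 12"

(* Integers rather than naturals, so that block_number v - 7 is not truncated at 0. *)
definition I3 :: "nat \<Rightarrow> int set" where
  "I3 v = {0..block_number v} - {block_number v - 7..block_number v - 1}"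

(* Points are taken in nat without loss of generality: every finite point set can be relabelled.
   The three designs need not be distinct. *)
definition J3 :: "nat \<Rightarrow> int set" where
  "J3 v = {k. \<exists>(V :: nat set) B1 B2 B3.
     S24_design v V B1 \<and> S24_design v V B2 \<and> S24_design v V B3 \<and>
     B1 \<inter> B2 = B1 \<inter> B3 \<and> B1 \<inter> B3 = B2 \<inter> B3 \<and>
     int (card (B1 \<inter> B2)) = k}"

end

theory Submission
  imports Defs
begin

text \<open>
  Let the volume of a triple of designs be the number of blocks of one of them outside the common part.

  A volume between 1 and 7 is impossible: discard the common blocks and take a point \<open>x\<close> of a remaining
  block. If all four points of that block have degree at least 3, there are at least 9 blocks. If \<open>x\<close> has
  degree 2, its neighbourhood is split into two triples in three different ways, and at least six pairs
  separated by the first splitting are joined in the second or third; the first design needs a separate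
  block for each of them.

  For the converse, give weight 3 to the points of a group divisible design with block sizes 4 and 5, type
  \<open>4\<^sup>u\<close> and at least one block of size 5, and add one point at infinity. This splits the complete graph on
  \<open>12u + 1\<close> points into \<open>u\<close> copies of \<open>K\<close>(13), copies of \<open>K\<close>(3,3,3,3) and at least one \<open>K\<close>(3,3,3,3,3).
  These pieces admit the volumes 0 and 8 to 13, the volumes 0 and 9, and the volumes 0, 14 and 15,
  respectively; volumes add up over the pieces, and the sums are 0 and everything from 8 on. The group
  divisible designs exist for all \<open>u \<ge> 5\<close>: difference families settle \<open>u < 28\<close>, and larger \<open>u\<close> are filled in
  recursively along a truncated transversal design with 7 groups of size \<open>m\<close>, \<open>m\<close> coprime to 30.
\<close>

section \<open>Decompositions of graphs into complete graphs\<close>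

text \<open>The volumes 14 and 15 shape the construction. Over copies of \<open>K\<close>(13) and
  \<open>K\<close>(3,3,3,3), one nonzero contribution is at most 13 and two already give at least
  16, so 14 and 15 must come from a single larger piece. \<open>K\<close>(3,3,3,3,3) has exactly 15
  blocks and attains both; hence the insistence on a block of size 5. Blocks of size 5 also open up
  the range of \<open>u\<close>: with blocks of size 4 only, the \<open>4 (u - 1)\<close> neighbours
  of a point would split into triples, forcing \<open>u\<close> to be 1 modulo 3. Weight 3 turns a
  group of 4 points plus infinity into 13 points, which carry the projective plane of order 3. Each
  piece attains its own number of blocks (13, 9 or 15) as a volume, so the total \<open>b_v\<close>,
  that is \<open>k = 0\<close>, is reached. In the recursion, keeping four of the seven groups full
  leaves 4 to 7 points on every truncated line, so the types \<open>4\<^sup>k\<close> with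
  \<open>k\<close> from 4 to 7 suffice for the lines. Truncated groups of size 2 or 3 must be
  avoided, since two or three groups have no block with 4 points; sizes 0 and 1 contain no pair and
  need no filling.\<close>

text \<open>Graphs are irreflexive symmetric sets of ordered pairs.\<close>

definition arcs :: "'a set \<Rightarrow> ('a \<times> 'a) set" where
  "arcs b = b \<times> b - Id"

text \<open>One notion serves for all designs in use: on \<open>arcs V\<close> it is a pairwise
  balanced design with block sizes in \<open>K\<close> (an S(2,4,v) for \<open>K = {4}\<close>), and
  on \<open>multipartite X w\<close> a group divisible design.\<close>

definition decomposes :: "nat set \<Rightarrow> ('a \<times> 'a) set \<Rightarrow> 'a set set \<Rightarrow> bool" where
  "decomposes K P B \<longleftrightarrow>
     (\<forall>b\<in>B. finite b \<and> card b \<in> K \<and> arcs b \<subseteq> P) \<and> (\<forall>p\<in>P. \<exists>!b. b \<in> B \<and> p \<in> arcs b)"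

text \<open>The complete multipartite graph with parts \<open>{x} \<times> {..<w}\<close>. The
  widths that occur are 1 (complete graphs), 3 (weighted blocks) and 4 (group divisible
  designs).\<close>

definition multipartite :: "'a set \<Rightarrow> nat \<Rightarrow> (('a \<times> nat) \<times> ('a \<times> nat)) set" where
  "multipartite X w = {((x, i), (y, j)). x \<in> X \<and> y \<in> X \<and> x \<noteq> y \<and> i < w \<and> j < w}"

text \<open>The number \<open>d\<close> counts the blocks outside the common part, so that it is additive over edge-disjoint
  unions of graphs.\<close>

definition three_way :: "('a \<times> 'a) set \<Rightarrow> nat \<Rightarrow> bool" where
  "three_way P d \<longleftrightarrow> (\<exists>B1 B2 B3. decomposes {4} P B1 \<and> decomposes {4} P B2 \<and> decomposes {4} P B3 \<and>
     B1 \<inter> B2 = B1 \<inter> B3 \<and> B1 \<inter> B3 = B2 \<inter> B3 \<and> card (B1 - B2) = d)"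

lemma mem_arcs [simp]: "(x, y) \<in> arcs b \<longleftrightarrow> x \<in> b \<and> y \<in> b \<and> x \<noteq> y"
  by (auto simp: arcs_def)

lemma finite_arcs [simp]: "finite b \<Longrightarrow> finite (arcs b)"
  by (simp add: arcs_def)

lemma card_arcs: "finite b \<Longrightarrow> card (arcs b) = card b * (card b - 1)"
proof -
  assume b: "finite b"
  have "arcs b = b \<times> b - (\<lambda>x. (x, x)) ` b" by (auto simp: arcs_def)
  moreover have "card ((\<lambda>x. (x, x)) ` b) = card b" by (rule card_image) (auto simp: inj_on_def)
  moreover have "(\<lambda>x. (x, x)) ` b \<subseteq> b \<times> b" by auto
  ultimately have "card (arcs b) = card b * card b - card b"
    using b by (simp add: card_Diff_subset card_cartesian_product)
  then show ?thesis by (simp add: diff_mult_distrib2)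
qed

lemma mem_multipartite [simp]:
  "((x, i), (y, j)) \<in> multipartite X w \<longleftrightarrow> x \<in> X \<and> y \<in> X \<and> x \<noteq> y \<and> i < w \<and> j < w"
  by (auto simp: multipartite_def)

lemma finite_multipartite [simp]: "finite X \<Longrightarrow> finite (multipartite X w)"
  by (rule finite_subset[of _ "(X \<times> {..<w}) \<times> (X \<times> {..<w})"]) (auto simp: multipartite_def)

lemma card_multipartite:
  assumes "finite X"
  shows "card (multipartite X w) = card X * (card X - 1) * w\<^sup>2"
proof -
  let ?f = "\<lambda>((x, i), (y, j)). ((x, y), (i, j))"
  have "bij_betw ?f (multipartite X w) (arcs X \<times> ({..<w} \<times> {..<w}))"
    by (rule bij_betw_byWitness[where f' = "\<lambda>((x, y), (i, j)). ((x, i), (y, j))"]) auto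
  then have "card (multipartite X w) = card (arcs X \<times> ({..<w} \<times> {..<w}))"
    by (rule bij_betw_same_card)
  then show ?thesis
    using assms by (simp add: card_arcs card_cartesian_product power2_eq_square)
qed

lemma decomposesI:
  assumes "\<And>b. b \<in> B \<Longrightarrow> finite b" "\<And>b. b \<in> B \<Longrightarrow> card b \<in> K" "\<And>b. b \<in> B \<Longrightarrow> arcs b \<subseteq> P"
    and "\<And>x y. (x, y) \<in> P \<Longrightarrow> x \<noteq> y \<and> (\<exists>b\<in>B. x \<in> b \<and> y \<in> b)"
    and "\<And>x y b c. (x, y) \<in> P \<Longrightarrow> b \<in> B \<Longrightarrow> c \<in> B \<Longrightarrow> x \<in> b \<Longrightarrow> y \<in> b \<Longrightarrow> x \<in> c \<Longrightarrow> y \<in> c \<Longrightarrow> b = c"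
  shows "decomposes K P B"
  unfolding decomposes_def
proof (intro conjI ballI)
  fix p assume p: "p \<in> P"
  obtain x y where xy: "p = (x, y)" by (cases p)
  with assms(4)[of x y] p obtain b where b: "x \<noteq> y" "b \<in> B" "x \<in> b" "y \<in> b" by blast
  show "\<exists>!b. b \<in> B \<and> p \<in> arcs b"
  proof (rule ex1I[of _ b])
    fix c assume "c \<in> B \<and> p \<in> arcs c"
    then show "c = b" using assms(5)[of x y c b] b p xy by simp
  qed (use b xy in simp)
qed (use assms in auto)

lemma decomposesD:
  assumes "decomposes K P B" "b \<in> B"
  shows "finite b" "card b \<in> K" "\<And>x y. x \<in> b \<Longrightarrow> y \<in> b \<Longrightarrow> x \<noteq> y \<Longrightarrow> (x, y) \<in> P"
  using assms unfolding decomposes_def by (auto simp: subset_iff)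

lemma decomposes_ex:
  assumes "decomposes K P B" "(x, y) \<in> P"
  shows "x \<noteq> y" "\<exists>b\<in>B. x \<in> b \<and> y \<in> b"
  using assms unfolding decomposes_def by fastforce+

lemma decomposes_unique:
  assumes "decomposes K P B" "b \<in> B" "c \<in> B" "x \<in> b" "y \<in> b" "x \<in> c" "y \<in> c" "x \<noteq> y"
  shows "b = c"
proof -
  have "(x, y) \<in> P" using decomposesD(3)[OF assms(1,2)] assms by auto
  then have "\<exists>!b. b \<in> B \<and> (x, y) \<in> arcs b" using assms(1) unfolding decomposes_def by blast
  with assms show ?thesis by (auto 4 4)
qed

text \<open>A block has all its pairs inside the graph of its own part, so two blocks that share a
  pair come from the same part.\<close>

lemma decomposes_UN:
  assumes dec: "\<And>i. i \<in> I \<Longrightarrow> decomposes K (Q i) (F i)"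
    and dis: "\<And>i j. i \<in> I \<Longrightarrow> j \<in> I \<Longrightarrow> i \<noteq> j \<Longrightarrow> Q i \<inter> Q j = {}"
  shows "decomposes K (\<Union>i\<in>I. Q i) (\<Union>i\<in>I. F i)"
proof (rule decomposesI)
  fix x y b c
  assume xy: "(x, y) \<in> (\<Union>i\<in>I. Q i)"
    and b: "b \<in> (\<Union>i\<in>I. F i)" "x \<in> b" "y \<in> b" and c: "c \<in> (\<Union>i\<in>I. F i)" "x \<in> c" "y \<in> c"
  from xy obtain k where "k \<in> I" "(x, y) \<in> Q k" by blast
  then have ne: "x \<noteq> y" using decomposes_ex(1)[OF dec] by blast
  from b c obtain i j where ij: "i \<in> I" "b \<in> F i" "j \<in> I" "c \<in> F j" by blast
  have "(x, y) \<in> Q i" "(x, y) \<in> Q j"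
    using decomposesD(3)[OF dec[OF ij(1)] ij(2)] decomposesD(3)[OF dec[OF ij(3)] ij(4)] b c ne
    by auto
  with dis[OF ij(1,3)] have "i = j" by blast
  with ij show "b = c" using decomposes_unique[OF dec[OF ij(1)]] b c ne by blast
next
  fix x y assume "(x, y) \<in> (\<Union>i\<in>I. Q i)"
  then obtain i where i: "i \<in> I" "(x, y) \<in> Q i" by blast
  from decomposes_ex[OF dec[OF i(1)] i(2)] i(1)
  show "x \<noteq> y \<and> (\<exists>b\<in>\<Union>i\<in>I. F i. x \<in> b \<and> y \<in> b)" by blast
next
  fix b assume "b \<in> (\<Union>i\<in>I. F i)"
  then obtain i where i: "i \<in> I" "b \<in> F i" by blast
  from decomposesD[OF dec[OF i(1)] i(2)] i(1)
  show "finite b" "card b \<in> K" "arcs b \<subseteq> (\<Union>i\<in>I. Q i)" by (auto simp: arcs_def)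
qed

lemma decomposes_Un:
  assumes "decomposes K P B" "decomposes K Q C" "P \<inter> Q = {}"
  shows "decomposes K (P \<union> Q) (B \<union> C)"
proof -
  have "decomposes K (\<Union>i. if i then P else Q) (\<Union>i. if i then B else C)"
    using assms by (intro decomposes_UN) (auto split: if_splits)
  then show ?thesis by (simp add: UNIV_bool Un_commute)
qed

lemma decomposes_image:
  assumes dec: "decomposes K P B" and inj: "inj_on f X" and X: "P \<subseteq> X \<times> X" "\<And>b. b \<in> B \<Longrightarrow> b \<subseteq> X"
  shows "decomposes K (map_prod f f ` P) ((`) f ` B)"
proof (rule decomposesI)
  fix b assume "b \<in> (`) f ` B"
  then obtain c where c: "c \<in> B" "b = f ` c" by blast
  have "inj_on f c" using inj X(2)[OF c(1)] inj_on_subset by blast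
  then show "finite b" "card b \<in> K" using c decomposesD[OF dec c(1)] by (auto simp: card_image)
  show "arcs b \<subseteq> map_prod f f ` P"
  proof
    fix p assume "p \<in> arcs b"
    then obtain x y where xy: "p = (f x, f y)" "x \<in> c" "y \<in> c" "x \<noteq> y"
      using c by (cases p) auto
    then show "p \<in> map_prod f f ` P" using decomposesD(3)[OF dec c(1)] by force
  qed
next
  fix x y assume "(x, y) \<in> map_prod f f ` P"
  then obtain p q where pq: "(p, q) \<in> P" "x = f p" "y = f q" by auto
  then show "x \<noteq> y \<and> (\<exists>b\<in>(`) f ` B. x \<in> b \<and> y \<in> b)"
    using decomposes_ex[OF dec pq(1)] X(1) inj_onD[OF inj, of p q] by auto
next
  fix x y b c
  assume xy: "(x, y) \<in> map_prod f f ` P" and b: "b \<in> (`) f ` B" "x \<in> b" "y \<in> b"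
    and c: "c \<in> (`) f ` B" "x \<in> c" "y \<in> c"
  obtain p q where pq: "(p, q) \<in> P" "x = f p" "y = f q" using xy by auto
  obtain b' c' where bc: "b' \<in> B" "b = f ` b'" "c' \<in> B" "c = f ` c'" using b c by blast
  have "p \<in> X" "q \<in> X" using pq X(1) by auto
  then have "p \<in> b'" "q \<in> b'" "p \<in> c'" "q \<in> c'"
    using b c pq bc X(2) inj_on_image_mem_iff[OF inj] by (metis)+
  then show "b = c" using decomposes_unique[OF dec bc(1,3)] decomposes_ex(1)[OF dec pq(1)] bc by blast
qed

text \<open>A block of size 0 or 1 has no arcs, so the graph does not constrain it; sizes at least 2
  tie every point of a block to some edge.\<close>

lemma decomposes_subset:
  assumes "decomposes K P B" "P \<subseteq> X \<times> X" "0 \<notin> K" "1 \<notin> K" "b \<in> B"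
  shows "b \<subseteq> X"
proof
  fix x assume x: "x \<in> b"
  have "card b \<noteq> 0" "card b \<noteq> 1" using decomposesD(2)[OF assms(1,5)] assms(3,4) by metis+
  then have "\<not> b \<subseteq> {x}" using x
    by (metis One_nat_def card.empty card_1_singleton_iff subset_singletonD)
  then obtain y where "y \<in> b" "x \<noteq> y" by blast
  then show "x \<in> X" using decomposesD(3)[OF assms(1,5) x] assms(2) by blast
qed

lemma decomposes_finite:
  assumes "decomposes K P B" "finite P" "0 \<notin> K" "1 \<notin> K"
  shows "finite B"
proof -
  have "P \<subseteq> (fst ` P \<union> snd ` P) \<times> (fst ` P \<union> snd ` P)" by force
  then have "B \<subseteq> Pow (fst ` P \<union> snd ` P)" using decomposes_subset[OF assms(1) _ assms(3,4)] by blast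
  then show ?thesis using assms(2) by (meson finite_Pow_iff finite_Un finite_imageI finite_subset)
qed

lemma decomposes_card:
  assumes "decomposes {k} P B" "finite P" "k > 1"
  shows "card P = k * (k - 1) * card B"
proof -
  have fin: "finite B" using decomposes_finite[OF assms(1,2)] assms(3) by auto
  have "P = (\<Union>b\<in>B. arcs b)" using assms(1) unfolding decomposes_def by blast
  also have "card \<dots> = (\<Sum>b\<in>B. card (arcs b))"
  proof (intro card_UN_disjoint ballI impI)
    fix b c assume "b \<in> B" "c \<in> B" "b \<noteq> c"
    then show "arcs b \<inter> arcs c = {}"
      using decomposes_unique[OF assms(1), of b c] unfolding arcs_def by blast
  qed (use fin decomposesD(1)[OF assms(1)] in auto)
  also have "\<dots> = (\<Sum>b\<in>B. k * (k - 1))"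
  proof (rule sum.cong)
    fix b assume "b \<in> B"
    from decomposesD(1,2)[OF assms(1) this] show "card (arcs b) = k * (k - 1)"
      by (simp add: card_arcs)
  qed simp
  finally show ?thesis by simp
qed

text \<open>Serves to delete the common blocks of three decompositions, which leaves three pairwise
  disjoint decompositions of one smaller graph.\<close>

lemma decomposes_Diff:
  assumes dec: "decomposes K P B" and "C \<subseteq> B"
  shows "decomposes K (P - (\<Union>c\<in>C. arcs c)) (B - C)"
proof (rule decomposesI)
  fix b assume b: "b \<in> B - C"
  then show "finite b" "card b \<in> K" using decomposesD[OF dec] by auto
  show "arcs b \<subseteq> P - (\<Union>c\<in>C. arcs c)"
    using decomposesD(3)[OF dec, of b] decomposes_unique[OF dec, of b] b assms(2)
    by (fastforce simp: arcs_def)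
next
  fix x y assume xy: "(x, y) \<in> P - (\<Union>c\<in>C. arcs c)"
  then show "x \<noteq> y \<and> (\<exists>b\<in>B - C. x \<in> b \<and> y \<in> b)" using decomposes_ex[OF dec, of x y] by auto
next
  fix x y b c assume "(x, y) \<in> P - (\<Union>c\<in>C. arcs c)" "b \<in> B - C" "c \<in> B - C"
    "x \<in> b" "y \<in> b" "x \<in> c" "y \<in> c"
  then show "b = c" using decomposes_unique[OF dec] decomposes_ex(1)[OF dec, of x y] by blast
qed

lemma S24_design_iff_decomposes:
  "S24_design v V B \<longleftrightarrow> finite V \<and> card V = v \<and> (\<forall>b\<in>B. b \<subseteq> V) \<and> decomposes {4} (arcs V) B"
proof -
  have "(\<forall>e. e \<subseteq> V \<and> card e = 2 \<longrightarrow> (\<exists>!b. b \<in> B \<and> e \<subseteq> b)) \<longleftrightarrow>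
      (\<forall>p\<in>arcs V. \<exists>!b. b \<in> B \<and> p \<in> arcs b)" (is "?L \<longleftrightarrow> ?R")
  proof
    assume L: ?L
    show ?R
    proof
      fix p assume "p \<in> arcs V"
      then obtain x y where p: "p = (x, y)" "x \<in> V" "y \<in> V" "x \<noteq> y" by (cases p) auto
      then have "{x, y} \<subseteq> V \<and> card {x, y} = 2" by simp
      with L have "\<exists>!b. b \<in> B \<and> {x, y} \<subseteq> b" by (elim allE[of _ "{x, y}"] impE)
      then show "\<exists>!b. b \<in> B \<and> p \<in> arcs b" using p by simp
    qed
  next
    assume R: ?R
    show ?L
    proof (intro allI impI)
      fix e assume e: "e \<subseteq> V \<and> card e = 2"
      then obtain x y where p: "e = {x, y}" "x \<noteq> y" by (meson card_2_iff)
      then have "(x, y) \<in> arcs V" using e by simp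
      with R have "\<exists>!b. b \<in> B \<and> (x, y) \<in> arcs b" by blast
      then show "\<exists>!b. b \<in> B \<and> e \<subseteq> b" using p by simp
    qed
  qed
  moreover have "(\<forall>b\<in>B. b \<subseteq> V \<and> card b = 4) \<longleftrightarrow>
      (\<forall>b\<in>B. b \<subseteq> V) \<and> (\<forall>b\<in>B. finite b \<and> card b \<in> {4} \<and> arcs b \<subseteq> arcs V)"
    using card_eq_0_iff by (fastforce simp: arcs_def)
  ultimately show ?thesis
    unfolding S24_design_def decomposes_def by argo
qed

section \<open>Volumes of triples of decompositions\<close>

lemma decomposes_disjoint:
  assumes "decomposes {4} P B" "decomposes {4} Q C" "P \<inter> Q = {}"
  shows "B \<inter> C = {}"
proof -
  have False if b: "b \<in> B" "b \<in> C" for b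
  proof -
    have "arcs b \<subseteq> P \<inter> Q" "finite b" "card b = 4"
      using b assms(1,2) unfolding decomposes_def by auto
    then show False using assms(3) card_arcs[of b] by auto
  qed
  then show ?thesis by blast
qed

lemma three_way_finite:
  "decomposes {4} P B \<Longrightarrow> finite P \<Longrightarrow> finite B"
  by (rule decomposes_finite) auto

text \<open>A block of size 4 over \<open>P\<close> has arcs in \<open>P\<close> and so is never a
  block over \<open>Q\<close>. Intersections and differences of the unions therefore split into the
  two parts, and volumes add.\<close>

lemma three_way_Un:
  assumes "three_way P d" "three_way Q e" "P \<inter> Q = {}" "finite P" "finite Q"
  shows "three_way (P \<union> Q) (d + e)"
proof -
  obtain B1 B2 B3 where B: "decomposes {4} P B1" "decomposes {4} P B2" "decomposes {4} P B3"
      "B1 \<inter> B2 = B1 \<inter> B3" "B1 \<inter> B3 = B2 \<inter> B3" "card (B1 - B2) = d"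
    using assms(1) unfolding three_way_def by blast
  obtain C1 C2 C3 where C: "decomposes {4} Q C1" "decomposes {4} Q C2" "decomposes {4} Q C3"
      "C1 \<inter> C2 = C1 \<inter> C3" "C1 \<inter> C3 = C2 \<inter> C3" "card (C1 - C2) = e"
    using assms(2) unfolding three_way_def by blast
  have dis: "B1 \<inter> C1 = {}" "B1 \<inter> C2 = {}" "B1 \<inter> C3 = {}" "B2 \<inter> C1 = {}" "B2 \<inter> C2 = {}"
      "B2 \<inter> C3 = {}" "B3 \<inter> C1 = {}" "B3 \<inter> C2 = {}" "B3 \<inter> C3 = {}"
    using decomposes_disjoint[OF _ _ assms(3)] B(1-3) C(1-3) by blast+
  have dec: "decomposes {4} (P \<union> Q) (B1 \<union> C1)" "decomposes {4} (P \<union> Q) (B2 \<union> C2)"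
      "decomposes {4} (P \<union> Q) (B3 \<union> C3)"
    using decomposes_Un[OF _ _ assms(3)] B(1-3) C(1-3) by blast+
  have "(B1 \<union> C1) \<inter> (B2 \<union> C2) = (B1 \<inter> B2) \<union> (C1 \<inter> C2)"
      "(B1 \<union> C1) \<inter> (B3 \<union> C3) = (B1 \<inter> B3) \<union> (C1 \<inter> C3)"
      "(B2 \<union> C2) \<inter> (B3 \<union> C3) = (B2 \<inter> B3) \<union> (C2 \<inter> C3)"
    using dis by blast+
  moreover have "(B1 \<union> C1) - (B2 \<union> C2) = (B1 - B2) \<union> (C1 - C2)"
    using dis by blast
  moreover have "finite B1" "finite C1" using B C assms(4,5) three_way_finite by blast+
  then have "card ((B1 - B2) \<union> (C1 - C2)) = d + e"
    using B C dis by (subst card_Un_disjoint) auto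
  ultimately show ?thesis using dec B C unfolding three_way_def by metis
qed

lemma three_way_image:
  assumes "three_way P d" "P \<subseteq> X \<times> X" "inj_on f X"
  shows "three_way (map_prod f f ` P) d"
proof -
  obtain B1 B2 B3 where B: "decomposes {4} P B1" "decomposes {4} P B2" "decomposes {4} P B3"
      "B1 \<inter> B2 = B1 \<inter> B3" "B1 \<inter> B3 = B2 \<inter> B3" "card (B1 - B2) = d"
    using assms(1) unfolding three_way_def by blast
  have sub: "B \<subseteq> Pow X" if "decomposes {4} P B" for B
    using decomposes_subset[OF that assms(2)] by auto
  have dec: "decomposes {4} (map_prod f f ` P) ((`) f ` B)" if "decomposes {4} P B" for B
    using that sub[OF that] by (intro decomposes_image[OF _ assms(3,2)]) auto
  have inj: "inj_on ((`) f) (Pow X)" using assms(3) by (rule inj_on_image_Pow)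
  have "(`) f ` B \<inter> (`) f ` C = (`) f ` (B \<inter> C)" if "B \<subseteq> Pow X" "C \<subseteq> Pow X" for B C
    using inj_on_image_Int[OF inj that] by simp
  moreover have "card ((`) f ` B1 - (`) f ` B2) = d"
  proof -
    have "(`) f ` B1 - (`) f ` B2 = (`) f ` (B1 - B2)"
      using inj_on_image_set_diff[OF inj] sub[OF B(1)] sub[OF B(2)] by (metis Diff_subset order_trans)
    moreover have "inj_on ((`) f) (B1 - B2)"
      by (rule inj_on_subset[OF inj]) (use sub[OF B(1)] in auto)
    ultimately show ?thesis using B(6) by (simp add: card_image)
  qed
  ultimately show ?thesis
    unfolding three_way_def using dec[OF B(1)] dec[OF B(2)] dec[OF B(3)] sub[OF B(1)] sub[OF B(2)]
      sub[OF B(3)] B(4,5) by metis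
qed

lemma three_way_0: "decomposes {4} P B \<Longrightarrow> three_way P 0"
  unfolding three_way_def by (intro exI[of _ B]) auto

section \<open>Lower bound 8 for nonzero volumes\<close>

lemma third_of_three:
  assumes "card B = 3" "s \<in> B" "t \<in> B" "s \<noteq> t"
  shows "\<exists>a. B = {s, t, a} \<and> a \<noteq> s \<and> a \<noteq> t"
proof -
  have "finite B" using assms(1) card_ge_0_finite by force
  then have "card (B - {s, t}) = 1" using assms by (simp add: card_Diff_subset)
  then obtain a where "B - {s, t} = {a}" by (meson card_1_singletonE)
  then show ?thesis using assms by blast
qed

lemma others_of_three:
  assumes "card B = 3" "s \<in> B"
  shows "\<exists>a b. B = {s, a, b} \<and> a \<noteq> s \<and> b \<noteq> s \<and> a \<noteq> b"
proof -
  have "card (B - {s}) = 2" using assms by simp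
  then obtain a b where "B - {s} = {a, b}" "a \<noteq> b" by (meson card_2_iff)
  then show ?thesis using assms by blast
qed

text \<open>Read \<open>A \<times> A'\<close> as a 3 by 3 grid. Each swap fills the row and the
  column of its cell without the cell itself, which makes four cells. Two such crosses with
  different centres share at most two cells, so at least 8 - 2 = 6 cells are filled.\<close>

lemma card_swaps_ge_6:
  assumes A: "card A = 3" "card A' = 3" "i \<in> A" "i' \<in> A" "j \<in> A'" "j' \<in> A'" "(i, j) \<noteq> (i', j')"
    and W: "finite W" "(A - {i}) \<times> {j} \<subseteq> W" "{i} \<times> (A' - {j}) \<subseteq> W"
      "(A - {i'}) \<times> {j'} \<subseteq> W" "{i'} \<times> (A' - {j'}) \<subseteq> W"
  shows "6 \<le> card W"
proof -
  have le: "6 \<le> card W" if "distinct xs" "length xs = 6" "set xs \<subseteq> W" for xs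
    using card_mono[OF W(1) that(3)] distinct_card[OF that(1)] that(2) by simp
  consider "i = i'" "j \<noteq> j'" | "i \<noteq> i'" "j = j'" | "i \<noteq> i'" "j \<noteq> j'" using A(7) by blast
  then show ?thesis
  proof cases
    case 1
    obtain a b where a: "A = {i, a, b}" "a \<noteq> i" "b \<noteq> i" "a \<noteq> b" using others_of_three[OF A(1,3)] by blast
    obtain l where l: "A' = {j, j', l}" "l \<noteq> j" "l \<noteq> j'" using third_of_three[OF A(2,5,6) 1(2)] by blast
    show ?thesis
      using a l 1 W by (intro le[of "[(a, j), (b, j), (a, j'), (b, j'), (i, l), (i, j)]"]) auto
  next
    case 2
    obtain a where a: "A = {i, i', a}" "a \<noteq> i" "a \<noteq> i'" using third_of_three[OF A(1,3,4) 2(1)] by blast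
    obtain l m where l: "A' = {j, l, m}" "l \<noteq> j" "m \<noteq> j" "l \<noteq> m" using others_of_three[OF A(2,5)] by blast
    show ?thesis
      using a l 2 W by (intro le[of "[(i, l), (i, m), (i', l), (i', m), (a, j), (i, j)]"]) auto
  next
    case 3
    obtain a where a: "A = {i, i', a}" "a \<noteq> i" "a \<noteq> i'" using third_of_three[OF A(1,3,4) 3(1)] by blast
    obtain l where l: "A' = {j, j', l}" "l \<noteq> j" "l \<noteq> j'" using third_of_three[OF A(2,5,6) 3(2)] by blast
    show ?thesis
      using a l 3 W by (intro le[of "[(a, j), (i', j), (i, j'), (i, l), (a, j'), (i', l)]"]) auto
  qed
qed

text \<open>The blocks of \<open>T\<close> through \<open>x\<close> split its six neighbours into
  triples. As \<open>c\<close> takes two points of \<open>A\<close> and hence one point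
  \<open>j\<close> of \<open>A'\<close>, the block through the left-over point \<open>i\<close> of
  \<open>A\<close> has only \<open>A' - {j}\<close> to draw its other two points from.\<close>

lemma swap_blocks:
  assumes dec: "decomposes {4} P T"
    and nb: "\<And>y. (x, y) \<in> P \<longleftrightarrow> y \<in> A \<union> A'" and "x \<notin> A" "x \<notin> A'" "A \<inter> A' = {}"
    and A: "card A = 3" "card A' = 3" and c: "c \<in> T" "x \<in> c" "card (c \<inter> A) = 2"
  shows "\<exists>i\<in>A. \<exists>j\<in>A'. insert x (insert j (A - {i})) \<in> T \<and> insert x (insert i (A' - {j})) \<in> T"
proof -
  have fin: "finite A" "finite A'" "finite c" "card c = 4"
    using A decomposesD[OF dec c(1)] by (auto intro: card_ge_0_finite)
  have c_sub: "c \<subseteq> insert x (A \<union> A')" using decomposesD(3)[OF dec c(1,2)] nb by blast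
  then have c_eq: "c = insert x ((c \<inter> A) \<union> (c \<inter> A'))" using c by blast
  have "card c = Suc (card (c \<inter> A) + card (c \<inter> A'))"
    using assms fin by (subst c_eq, subst card_insert_disjoint, simp, simp, subst card_Un_disjoint) auto
  then have "card (c \<inter> A') = 1" using fin c by simp
  then obtain j where j: "c \<inter> A' = {j}" by (meson card_1_singletonE)
  have "card (A - c) = 1" using A c fin card_Diff_subset_Int[of A c] by (simp add: Int_commute)
  then obtain i where i: "A - c = {i}" by (meson card_1_singletonE)
  have cA: "c \<inter> A = A - {i}" using i by blast
  have c1: "c = insert x (insert j (A - {i}))" using c_eq cA j by auto
  have ij: "i \<in> A" "i \<notin> c" "j \<in> A'" "j \<in> c" using i j by auto
  then obtain c' where c': "c' \<in> T" "x \<in> c'" "i \<in> c'"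
    using decomposes_ex(2)[OF dec, of x i] nb by blast
  have "c' \<noteq> c" using ij c' by blast
  then have "y \<notin> c'" if "y \<in> c" "y \<noteq> x" for y
    using decomposes_unique[OF dec c'(1) c(1)] that c' c by blast
  moreover have "c' \<subseteq> insert x (A \<union> A')" using decomposesD(3)[OF dec c'(1,2)] nb by blast
  ultimately have "c' \<subseteq> insert x (insert i (A' - {j}))"
    using ij cA assms(3,4) by blast
  moreover have "card (insert x (insert i (A' - {j}))) = 4"
    using fin ij assms by (subst card_insert_disjoint, simp, force, subst card_insert_disjoint) auto
  moreover have "card c' = 4" using decomposesD[OF dec c'(1)] by simp
  ultimately have "c' = insert x (insert i (A' - {j}))"
    using fin by (intro card_subset_eq) auto
  then show ?thesis using c1 c c' ij by blast
qed

lemma three_disjoint_ge_8: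
  assumes dec: "decomposes {4} P T1" "decomposes {4} P T2" "decomposes {4} P T3"
    and dis: "T1 \<inter> T2 = {}" "T1 \<inter> T3 = {}" "T2 \<inter> T3 = {}" and fin: "finite P" and b: "b \<in> T1"
  shows "8 \<le> card T1"
proof -
  let ?S = "\<lambda>x. {c \<in> T1. x \<in> c}"
  have finT: "finite T1" using dec(1) fin by (rule three_way_finite)
  have b4: "finite b" "card b = 4" using decomposesD[OF dec(1) b] by auto
  \<comment> \<open>A block of \<open>T2\<close> through \<open>x\<close> and another point of
    \<open>b\<close> differs from \<open>b\<close>, so it contains some \<open>z\<close> outside
    \<open>b\<close>. The pair of \<open>x\<close> and \<open>z\<close> then needs a second block of
    \<open>T1\<close> through \<open>x\<close>.\<close>
  have two: "2 \<le> card (?S x)" if x: "x \<in> b" for x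
  proof -
    have "\<not> b \<subseteq> {x}" using b4 card_mono[of "{x}" b] by auto
    then obtain y where y: "y \<in> b" "y \<noteq> x" by blast
    then obtain c where c: "c \<in> T2" "x \<in> c" "y \<in> c"
      using decomposes_ex(2)[OF dec(2), of x y] decomposesD(3)[OF dec(1) b x y(1)] by blast
    have c4: "finite c" "card c = 4" using decomposesD[OF dec(2) c(1)] by auto
    have "c \<noteq> b" using c dis b by blast
    then have "\<not> c \<subseteq> b" using card_subset_eq[of b c] b4 c4 by auto
    then obtain z where z: "z \<in> c" "z \<notin> b" by blast
    then have "(x, z) \<in> P" using decomposesD(3)[OF dec(2) c(1,2) z(1)] x by blast
    then obtain b' where b': "b' \<in> T1" "x \<in> b'" "z \<in> b'"
      using decomposes_ex(2)[OF dec(1)] by blast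
    have "card {b, b'} \<le> card (?S x)" using finT b x b' by (intro card_mono) auto
    moreover have "b \<noteq> b'" using z b' by blast
    ultimately show ?thesis by simp
  qed
  show ?thesis
  proof (cases "\<exists>x\<in>b. card (?S x) = 2")
    case False
    \<comment> \<open>All four points have degree at least 3. The further blocks at different points
      of \<open>b\<close> are different, since a block meeting \<open>b\<close> twice is
      \<open>b\<close>.\<close>
    then have ge: "2 \<le> card (?S x - {b})" if "x \<in> b" for x
      using two[OF that] that b finT by (auto simp: card_Diff_singleton_if le_less)
    have "2 * card b = (\<Sum>x\<in>b. 2)" by simp
    also have "\<dots> \<le> (\<Sum>x\<in>b. card (?S x - {b}))" using ge by (rule sum_mono)
    also have "\<dots> = card (\<Union>x\<in>b. ?S x - {b})"
      using b4 finT decomposes_unique[OF dec(1) b]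
      by (intro card_UN_disjoint[symmetric]) (simp, simp, blast)
    also have "\<dots> \<le> card T1" using finT by (intro card_mono) auto
    finally show ?thesis using b4 by simp
  next
    case True
    then obtain x where x: "x \<in> b" "card (?S x) = 2" by blast
    have "card (?S x - {b}) = 1" using x b finT by simp
    then obtain b' where b': "?S x - {b} = {b'}" by (meson card_1_singletonE)
    then have S: "?S x = {b, b'}" "b \<noteq> b'" "b' \<in> T1" "x \<in> b'" using b x by auto
    have b4': "finite b'" "card b' = 4" using decomposesD[OF dec(1) S(3)] by auto
    define A A' where "A = b - {x}" and "A' = b' - {x}"
    have A: "card A = 3" "card A' = 3" "x \<notin> A" "x \<notin> A'" "finite A" "finite A'"
      using b4 b4' x S by (auto simp: A_def A'_def)
    have AA: "A \<inter> A' = {}"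
      using decomposes_unique[OF dec(1) b S(3)] S(2,4) x unfolding A_def A'_def by blast
    have nb: "(x, y) \<in> P \<longleftrightarrow> y \<in> A \<union> A'" for y
    proof
      assume "(x, y) \<in> P"
      then obtain c where "c \<in> T1" "x \<in> c" "y \<in> c" "x \<noteq> y"
        using decomposes_ex[OF dec(1)] by blast
      then show "y \<in> A \<union> A'" using S(1) unfolding A_def A'_def by blast
    next
      assume "y \<in> A \<union> A'"
      then show "(x, y) \<in> P"
        using decomposesD(3)[OF dec(1) b x(1)] decomposesD(3)[OF dec(1) S(3,4)]
        unfolding A_def A'_def by blast
    qed
    \<comment> \<open>A decomposition disjoint from \<open>T1\<close> cannot use the triple
      \<open>A\<close> at \<open>x\<close>, because \<open>insert x A\<close> is \<open>b\<close>.
      So its block through \<open>x\<close> and a point of \<open>A\<close> meets one of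
      \<open>A\<close>, \<open>A'\<close> in exactly two points, and \<open>swap_blocks\<close>
      applies up to exchanging the two.\<close>
    have swap: "\<exists>i\<in>A. \<exists>j\<in>A'. insert x (insert j (A - {i})) \<in> T \<and> insert x (insert i (A' - {j})) \<in> T"
      if T: "decomposes {4} P T" "T1 \<inter> T = {}" for T
    proof -
      obtain a where "a \<in> A" using A by fastforce
      then obtain c where c: "c \<in> T" "x \<in> c" "a \<in> c"
        using decomposes_ex(2)[OF T(1)] nb by blast
      have c4: "finite c" "card c = 4" using decomposesD[OF T(1) c(1)] by auto
      have "c \<subseteq> insert x (A \<union> A')" using decomposesD(3)[OF T(1) c(1,2)] nb by blast
      then have c_eq: "c = insert x ((c \<inter> A) \<union> (c \<inter> A'))" using c by blast
      have "card c = Suc (card (c \<inter> A) + card (c \<inter> A'))"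
        using A AA by (subst c_eq, subst card_insert_disjoint, simp, simp, subst card_Un_disjoint) auto
      moreover have "card (c \<inter> A) \<noteq> 0" using \<open>a \<in> A\<close> c A by auto
      moreover have "card (c \<inter> A) \<noteq> 3"
      proof
        assume "card (c \<inter> A) = 3"
        then have "c \<inter> A = A" using A by (intro card_subset_eq) auto
        then have "b \<subseteq> c" using c unfolding A_def by blast
        then have "b = c" using b4 c4 by (intro card_subset_eq) auto
        then show False using T b c by blast
      qed
      ultimately have "card (c \<inter> A) = 2 \<or> card (c \<inter> A') = 2"
        using c4 by arith
      then show ?thesis
      proof
        assume "card (c \<inter> A) = 2"
        then show ?thesis using swap_blocks[OF T(1) nb A(3,4) AA A(1,2) c(1,2)] by blast
      next
        assume "card (c \<inter> A') = 2"
        then show ?thesis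
          using swap_blocks[OF T(1) _ A(4,3) _ A(2,1) c(1,2)] nb AA by (metis Int_commute Un_commute)
      qed
    qed
    obtain i j where ij: "i \<in> A" "j \<in> A'" "insert x (insert j (A - {i})) \<in> T2"
        "insert x (insert i (A' - {j})) \<in> T2"
      using swap[OF dec(2) dis(1)] by blast
    obtain i' j' where ij': "i' \<in> A" "j' \<in> A'" "insert x (insert j' (A - {i'})) \<in> T3"
        "insert x (insert i' (A' - {j'})) \<in> T3"
      using swap[OF dec(3) dis(2)] by blast
    \<comment> \<open>Equal swaps would put the same block into \<open>T2\<close> and
      \<open>T3\<close>.\<close>
    have "(i, j) \<noteq> (i', j')" using ij ij' dis(3) by blast
    define W where "W = A \<times> A' \<inter> P"
    have W_I: "(p, q) \<in> W" if "c \<in> T" "decomposes {4} P T" "p \<in> A" "q \<in> A'" "p \<in> c" "q \<in> c" for p q c T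
      using decomposesD(3)[OF that(2,1,5,6)] that(3,4) AA unfolding W_def by blast
    have W6: "6 \<le> card W"
    proof (rule card_swaps_ge_6[OF A(1,2) ij(1) ij'(1) ij(2) ij'(2) \<open>(i, j) \<noteq> (i', j')\<close>])
      show "finite W" using A by (simp add: W_def)
      show "(A - {i}) \<times> {j} \<subseteq> W" "{i} \<times> (A' - {j}) \<subseteq> W"
        using W_I[OF ij(3) dec(2)] W_I[OF ij(4) dec(2)] ij by auto
      show "(A - {i'}) \<times> {j'} \<subseteq> W" "{i'} \<times> (A' - {j'}) \<subseteq> W"
        using W_I[OF ij'(3) dec(3)] W_I[OF ij'(4) dec(3)] ij' by auto
    qed
    have "\<exists>c. c \<in> T1 \<and> fst w \<in> c \<and> snd w \<in> c" if "w \<in> W" for w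
      using decomposes_ex(2)[OF dec(1), of "fst w" "snd w"] that unfolding W_def by auto
    then obtain \<beta> where \<beta>: "\<beta> w \<in> T1" "fst w \<in> \<beta> w" "snd w \<in> \<beta> w" if "w \<in> W" for w by metis
    have \<beta>_new: "\<beta> w \<noteq> b" "\<beta> w \<noteq> b'" if "w \<in> W" for w
    proof -
      have "fst w \<notin> b'" "snd w \<notin> b"
        using that AA A(3,4) unfolding W_def A_def A'_def by auto
      then show "\<beta> w \<noteq> b" "\<beta> w \<noteq> b'" using \<beta>(2,3)[OF that] by metis+
    qed
    \<comment> \<open>The block \<open>\<beta> w\<close> is neither \<open>b\<close> nor
      \<open>b'\<close>, so it meets each of them in at most one point; hence it determines both
      coordinates of \<open>w\<close>. With \<open>b\<close> and \<open>b'\<close> this makes 6 + 2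
      blocks.\<close>
    have "inj_on \<beta> W"
    proof (rule inj_onI)
      fix v w assume vw: "v \<in> W" "w \<in> W" "\<beta> v = \<beta> w"
      have mem: "fst v \<in> b" "fst w \<in> b" "snd v \<in> b'" "snd w \<in> b'"
        using vw(1,2) unfolding W_def A_def A'_def by auto
      have "fst v = fst w"
        using decomposes_unique[OF dec(1) b \<beta>(1)[OF vw(1)] mem(1,2)] \<beta>(2)[OF vw(1)] \<beta>(2)[OF vw(2)]
          \<beta>_new(1)[OF vw(1)] vw(3) by metis
      moreover have "snd v = snd w"
        using decomposes_unique[OF dec(1) S(3) \<beta>(1)[OF vw(1)] mem(3,4)] \<beta>(3)[OF vw(1)] \<beta>(3)[OF vw(2)]
          \<beta>_new(2)[OF vw(1)] vw(3) by metis
      ultimately show "v = w" by (rule prod_eqI)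
    qed
    then have "card W = card (\<beta> ` W)" by (simp add: card_image)
    also have "\<dots> \<le> card (T1 - {b, b'})"
    proof (rule card_mono)
      show "\<beta> ` W \<subseteq> T1 - {b, b'}" using \<beta>(1) \<beta>_new by blast
    qed (use finT in simp)
    also have "\<dots> = card T1 - 2" using b S finT by (simp add: card_Diff_subset)
    finally show ?thesis using W6 by simp
  qed
qed

lemma three_way_volume:
  assumes "three_way P d" "finite P"
  shows "d = 0 \<or> 8 \<le> d"
proof -
  obtain B1 B2 B3 where B: "decomposes {4} P B1" "decomposes {4} P B2" "decomposes {4} P B3"
      "B1 \<inter> B2 = B1 \<inter> B3" "B1 \<inter> B3 = B2 \<inter> B3" "card (B1 - B2) = d"
    using assms(1) unfolding three_way_def by blast
  let ?C = "B1 \<inter> B2"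
  have "decomposes {4} (P - (\<Union>c\<in>?C. arcs c)) (B - ?C)" if "B \<in> {B1, B2, B3}" for B
    using that B by (intro decomposes_Diff) auto
  then have dec: "decomposes {4} (P - (\<Union>c\<in>?C. arcs c)) (B1 - ?C)"
      "decomposes {4} (P - (\<Union>c\<in>?C. arcs c)) (B2 - ?C)"
      "decomposes {4} (P - (\<Union>c\<in>?C. arcs c)) (B3 - ?C)"
    by auto
  have "8 \<le> card (B1 - ?C)" if "b \<in> B1 - ?C" for b
    by (rule three_disjoint_ge_8[OF dec _ _ _ _ that]) (use B assms in auto)
  moreover have "B1 - ?C = B1 - B2" by blast
  moreover have "finite B1" using B assms three_way_finite by blast
  ultimately show ?thesis using B(6) by (cases "B1 - B2 = {}") auto
qed

section \<open>Group divisible designs from pairwise balanced designs\<close>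

text \<open>A decomposition of \<open>multipartite {..<u} 4\<close> into complete graphs is a group divisible design of type
  \<open>4\<^sup>u\<close>.\<close>

definition GDD45 :: "nat \<Rightarrow> bool" where
  "GDD45 u \<longleftrightarrow> (\<exists>B. decomposes {4, 5} (multipartite {..<u} 4) B)"

text \<open>Strictly stronger than \<open>GDD45\<close>: for \<open>u = 4\<close> a block meets each
  of the four groups at most once and cannot have 5 points. The recursion uses the weak form for
  most ingredients and the strong form for one.\<close>

definition GDD45_with5 :: "nat \<Rightarrow> bool" where
  "GDD45_with5 u \<longleftrightarrow> (\<exists>B. decomposes {4, 5} (multipartite {..<u} 4) B \<and> (\<exists>b\<in>B. card b = 5))"

lemma GDD45_with5_imp: "GDD45_with5 u \<Longrightarrow> GDD45 u"
  unfolding GDD45_def GDD45_with5_def by blast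

lemma multipartite_subset: "multipartite X w \<subseteq> (X \<times> {..<w}) \<times> (X \<times> {..<w})"
  by (auto simp: multipartite_def)

lemma multipartite_bij:
  assumes f: "bij_betw f X Y"
  shows "inj_on (map_prod f id) (X \<times> {..<w})"
    and "map_prod (map_prod f id) (map_prod f id) ` multipartite X w = multipartite Y w"
      (is "?L = ?R")
proof -
  show "inj_on (map_prod f id) (X \<times> {..<w})"
    using f by (intro map_prod_inj_on) (auto simp: bij_betw_def)
  show "?L = ?R"
  proof
    show "?L \<subseteq> ?R"
      using bij_betw_apply[OF f] inj_onD[OF bij_betw_imp_inj_on[OF f]]
      unfolding multipartite_def by fastforce
    show "?R \<subseteq> ?L"
    proof
      fix p assume "p \<in> ?R"
      then obtain a i b j where p: "p = ((a, i), (b, j))" "a \<in> Y" "b \<in> Y" "a \<noteq> b" "i < w" "j < w"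
        by (auto simp: multipartite_def)
      then obtain x y where "x \<in> X" "y \<in> X" "a = f x" "b = f y"
        using f by (auto simp: bij_betw_def)
      then show "p \<in> ?L" using p by (intro image_eqI[of _ _ "((x, i), (y, j))"]) auto
    qed
  qed
qed

lemma multipartite_transfer:
  assumes dec: "decomposes {4, 5} (multipartite X w) B" and "finite X" "finite Y" "card X = card Y"
  shows "\<exists>C. decomposes {4, 5} (multipartite Y w) C \<and> ((\<exists>b\<in>B. card b = 5) \<longrightarrow> (\<exists>b\<in>C. card b = 5))"
proof -
  obtain f where f: "bij_betw f X Y"
    using assms finite_same_card_bij by blast
  have sub: "b \<subseteq> X \<times> {..<w}" if "b \<in> B" for b
    using decomposes_subset[OF dec multipartite_subset _ _ that] by simp
  then have "decomposes {4, 5} (multipartite Y w) ((`) (map_prod f id) ` B)"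
    using decomposes_image[OF dec multipartite_bij(1)[OF f] multipartite_subset]
    unfolding multipartite_bij(2)[OF f] by blast
  moreover have "card (map_prod f id ` b) = 5" if b: "b \<in> B" "card b = 5" for b
  proof -
    have "inj_on (map_prod f id) b" by (rule inj_on_subset[OF multipartite_bij(1)[OF f] sub[OF b(1)]])
    then show ?thesis using b by (simp add: card_image)
  qed
  ultimately show ?thesis by blast
qed

text \<open>Weight 4 on the points of a pairwise balanced design turns a block \<open>k\<close> into
  the graph \<open>multipartite k 4\<close>, and these graphs partition the edges of
  \<open>multipartite I 4\<close>. Each is filled by its own group divisible design; the filling of
  \<open>l\<close> alone supplies the block of size 5.\<close>

lemma GDD45_pbd:
  assumes pbd: "decomposes U (arcs I) L" and "finite I"
    and gdd: "\<And>u. u \<in> U \<Longrightarrow> GDD45 u" and l: "l \<in> L" "GDD45_with5 (card l)"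
  shows "GDD45_with5 (card I)"
proof -
  have ex: "\<exists>C. decomposes {4, 5} (multipartite k 4) C \<and> (k = l \<longrightarrow> (\<exists>b\<in>C. card b = 5))"
    if k: "k \<in> L" for k
  proof (cases "k = l")
    case True
    have "finite l" using decomposesD[OF pbd l(1)] by simp
    then show ?thesis
      using l(2) True multipartite_transfer[of "{..<card l}" 4 _ l] unfolding GDD45_with5_def
      by (metis card_lessThan finite_lessThan)
  next
    case False
    have "finite k" "GDD45 (card k)" using decomposesD[OF pbd k] gdd by auto
    then show ?thesis
      using False multipartite_transfer[of "{..<card k}" 4 _ k] unfolding GDD45_def
      by (metis card_lessThan finite_lessThan)
  qed
  then obtain C where C: "decomposes {4, 5} (multipartite k 4) (C k)" "k = l \<Longrightarrow> \<exists>b\<in>C k. card b = 5"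
    if "k \<in> L" for k by metis
  have "decomposes {4, 5} (\<Union>k\<in>L. multipartite k 4) (\<Union>k\<in>L. C k)"
  proof (rule decomposes_UN)
    fix k m assume km: "k \<in> L" "m \<in> L" "k \<noteq> m"
    have "\<not> (x \<in> k \<and> y \<in> k \<and> x \<in> m \<and> y \<in> m \<and> x \<noteq> y)" for x y
      using decomposes_unique[OF pbd km(1,2)] km(3) by blast
    then show "multipartite k 4 \<inter> multipartite m 4 = {}" by (auto simp: multipartite_def)
  qed (rule C)
  moreover have "(\<Union>k\<in>L. multipartite k 4) = multipartite I 4"
  proof -
    have "x \<in> I \<and> y \<in> I \<and> x \<noteq> y \<longleftrightarrow> (\<exists>k\<in>L. x \<in> k \<and> y \<in> k \<and> x \<noteq> y)" for x y
      using decomposes_ex[OF pbd, of x y] decomposesD(3)[OF pbd, of _ x y] by auto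
    then show ?thesis unfolding multipartite_def by blast
  qed
  ultimately have "decomposes {4, 5} (multipartite I 4) (\<Union>k\<in>L. C k)" by simp
  then show ?thesis
    using multipartite_transfer[of I 4 _ "{..<card I}"] assms(2) C(2)[OF l(1) refl] l(1)
    unfolding GDD45_with5_def by (metis UN_I card_lessThan finite_lessThan)
qed

text \<open>The differences of two columns among 0, ..., 6 have absolute value at most 6, hence are units modulo
  every \<open>m\<close> coprime to 30. So the lines \<open>j \<mapsto> a + b j\<close> form a transversal design with 7 groups.\<close>

lemma affine_line_unique:
  fixes m :: int
  assumes "m > 0" "j < 7" "k < 7" "j \<noteq> k" "coprime m 30"
  shows "\<exists>!p. fst p \<in> {0..<m} \<and> snd p \<in> {0..<m} \<and>
    (fst p + snd p * int j) mod m = x mod m \<and> (fst p + snd p * int k) mod m = y mod m"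
proof -
  define e where "e = int j - int k"
  have "coprime e m"
  proof -
    have c: "coprime 2 m" "coprime 3 m" "coprime 5 m"
      using coprime_divisors[of 2 30 m m] coprime_divisors[of 3 30 m m] coprime_divisors[of 5 30 m m]
        assms(5) by (auto simp: coprime_commute)
    have "coprime (2 * 2) m" "coprime (2 * 3) m" using c by (simp_all only: coprime_mult_left_iff)
    then have c': "coprime 4 m" "coprime 6 m" by simp_all
    have "\<bar>e\<bar> \<in> {1, 2, 3, 4, 5, 6}" using assms(2-4) unfolding e_def by auto
    then have "coprime \<bar>e\<bar> m" using c c' by (metis insert_iff empty_iff coprime_1_left)
    then show ?thesis by simp
  qed
  then obtain i where i: "[e * i = 1] (mod m)" using cong_solve_coprime_int by blast
  \<comment> \<open>Subtracting the two congruences leaves \<open>e * b = x - y\<close>, solved with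
    the inverse \<open>i\<close> of \<open>e\<close>; the intercept \<open>a\<close>
    follows.\<close>
  define b a where "b = ((x - y) * i) mod m" and "a = (x - b * int j) mod m"
  have "[e * b = e * ((x - y) * i)] (mod m)" unfolding b_def by (simp add: cong_def mod_mult_right_eq)
  also have "e * ((x - y) * i) = (x - y) * (e * i)" by simp
  also have "[\<dots> = (x - y) * 1] (mod m)" using i by (rule cong_scalar_left)
  finally have eb: "[e * b = x - y] (mod m)" by simp
  show ?thesis
  proof (rule ex1I[of _ "(a, b)"], intro conjI)
    have 1: "[a + b * int j = x] (mod m)" unfolding a_def
      by (simp add: cong_def mod_add_left_eq)
    then show "(fst (a, b) + snd (a, b) * int j) mod m = x mod m" by (simp add: cong_def)
    have "[a + b * int j - e * b = x - (x - y)] (mod m)" using 1 eb by (rule cong_diff)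
    moreover have "a + b * int j - e * b = a + b * int k" by (simp add: e_def algebra_simps)
    ultimately show "(fst (a, b) + snd (a, b) * int k) mod m = y mod m" by (simp add: cong_def)
  next
    fix p assume p: "fst p \<in> {0..<m} \<and> snd p \<in> {0..<m} \<and>
      (fst p + snd p * int j) mod m = x mod m \<and> (fst p + snd p * int k) mod m = y mod m"
    then have 1: "[fst p + snd p * int j = x] (mod m)" and 2: "[fst p + snd p * int k = y] (mod m)"
      by (simp_all add: cong_def)
    have "[(fst p + snd p * int j) - (fst p + snd p * int k) = x - y] (mod m)"
      using 1 2 by (rule cong_diff)
    then have "[e * snd p = x - y] (mod m)" by (simp add: e_def algebra_simps)
    then have "[e * snd p = e * b] (mod m)" using eb by (metis cong_sym cong_trans)
    then have "[snd p = b] (mod m)" using \<open>coprime e m\<close> by (simp add: cong_mult_lcancel)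
    then have b: "snd p = b" using p assms(1) unfolding cong_def b_def by simp
    have "[fst p + snd p * int j - b * int j = x - b * int j] (mod m)" using 1 by (intro cong_diff) auto
    then have "[fst p = x - b * int j] (mod m)" using b by simp
    then have "fst p = a" using p unfolding cong_def a_def by simp
    with b show "p = (a, b)" by (simp add: prod_eq_iff)
  qed (use assms(1) in \<open>auto simp: a_def b_def\<close>)
qed

text \<open>The truncated groups with at least two points and the truncated lines form a pairwise
  balanced design: two points of one group lie in that group only, and points of different groups
  lie on exactly one line. Since groups 0 to 3 stay full, every line keeps 4 to 7 points. The block
  of size 5 comes from filling the full group 0.\<close>

lemma GDD45_truncated:
  fixes m :: nat and s :: "nat \<Rightarrow> nat"
  assumes m: "m \<ge> 7" "coprime m 30" and s: "\<And>j. j < 4 \<Longrightarrow> s j = m" "\<And>j. j < 7 \<Longrightarrow> s j \<le> m"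
    and gdd: "\<And>j. j < 7 \<Longrightarrow> s j \<ge> 2 \<Longrightarrow> GDD45 (s j)" "GDD45 4" "GDD45 5" "GDD45 6" "GDD45 7"
    and m5: "GDD45_with5 m"
  shows "GDD45_with5 (\<Sum>j<7. s j)"
proof -
  define I where "I = (SIGMA j:{..<7::nat}. int ` {..<s j})"
  define G where "G j = {j} \<times> int ` {..<s j}" for j :: nat
  define A where "A a b = {(j, (a + b * int j) mod int m) |j. j < 7} \<inter> I" for a b
  define L where "L = G ` {j. j < 7 \<and> s j \<ge> 2} \<union> case_prod A ` ({0..<int m} \<times> {0..<int m})"
  have range: "int ` {..<s j} \<subseteq> {0..<int m}" if "j < 7" for j using s(2)[OF that] by auto
  have full: "int ` {..<s j} = {0..<int m}" if "j < 4" for j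
    using s(1)[OF that] by (auto simp: image_iff) (metis nat_0_le lessThan_iff nat_less_iff)
  have m': "int m > 0" and cop: "coprime (int m) 30"
    using m coprime_int_iff[of m 30] by simp_all
  have finI: "finite I" by (simp add: I_def)
  have cardI: "card I = (\<Sum>j<7. s j)" by (simp add: I_def card_image)
  have "decomposes ({s j |j. j < 7 \<and> s j \<ge> 2} \<union> {4, 5, 6, 7}) (arcs I) L"
  proof (rule decomposesI)
    fix b assume b: "b \<in> L"
    have sub: "b \<subseteq> I" using b unfolding L_def G_def A_def I_def by auto
    then show "finite b" using finI finite_subset by blast
    show "arcs b \<subseteq> arcs I" using sub by (auto simp: arcs_def)
    show "card b \<in> {s j |j. j < 7 \<and> s j \<ge> 2} \<union> {4, 5, 6, 7}"
    proof (cases "b \<in> G ` {j. j < 7 \<and> s j \<ge> 2}")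
      case True
      then show ?thesis by (auto simp: G_def card_cartesian_product_singleton card_image)
    next
      case False
      then obtain c d where b: "b = A c d" using b unfolding L_def by auto
      let ?f = "\<lambda>j. (j, (c + d * int j) mod int m)"
      have inj: "inj_on ?f J" for J by (auto simp: inj_on_def)
      have up: "b \<subseteq> ?f ` {..<7}" unfolding b A_def by auto
      have lo: "?f ` {..<4} \<subseteq> b"
        using full m(1) unfolding b A_def I_def by auto
      have "card (?f ` {..<4}) \<le> card b"
        using up by (intro card_mono[OF _ lo]) (meson finite_imageI finite_lessThan finite_subset)
      moreover have "card b \<le> card (?f ` {..<7})" using up by (intro card_mono) auto
      ultimately have "4 \<le> card b" "card b \<le> 7" by (simp_all add: card_image[OF inj])
      then have "card b \<in> {4, 5, 6, 7}" by auto
      then show ?thesis by blast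
    qed
  next
    fix p q assume "(p, q) \<in> arcs I"
    then obtain j x k y where pq: "p = (j, x)" "q = (k, y)" "(j, x) \<in> I" "(k, y) \<in> I" "p \<noteq> q"
      by (cases p, cases q) auto
    have "\<exists>b\<in>L. p \<in> b \<and> q \<in> b"
    proof (cases "j = k")
      case True
      then have xy: "x \<in> int ` {..<s j}" "y \<in> int ` {..<s j}" "x \<noteq> y" "j < 7"
        using pq unfolding I_def by simp_all
      then have "card {x, y} \<le> card (int ` {..<s j})" by (intro card_mono) simp_all
      then have "s j \<ge> 2" using xy by (simp add: card_image)
      then have "G j \<in> L" using xy unfolding L_def by simp
      moreover have "p \<in> G j" "q \<in> G j" using pq True xy unfolding G_def by simp_all
      ultimately show ?thesis by blast
    next
      case False
      have lt: "j < 7" "k < 7" using pq unfolding I_def by auto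
      have xy: "x \<in> {0..<int m}" "y \<in> {0..<int m}"
        using pq range[OF lt(1)] range[OF lt(2)] unfolding I_def by blast+
      obtain a b where ab: "a \<in> {0..<int m}" "b \<in> {0..<int m}"
          "(a + b * int j) mod int m = x mod int m" "(a + b * int k) mod int m = y mod int m"
        using ex1_implies_ex[OF affine_line_unique[OF m' lt False cop, of x y]] by blast
      have "p \<in> A a b" "q \<in> A a b"
        using ab(3,4) pq xy lt unfolding A_def by auto
      moreover have "A a b \<in> L" using ab unfolding L_def by auto
      ultimately show ?thesis by blast
    qed
    then show "p \<noteq> q \<and> (\<exists>b\<in>L. p \<in> b \<and> q \<in> b)" using pq by simp
  next
    fix p q b c
    assume "(p, q) \<in> arcs I" and bc: "b \<in> L" "c \<in> L" "p \<in> b" "q \<in> b" "p \<in> c" "q \<in> c"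
    then obtain j x k y where pq: "p = (j, x)" "q = (k, y)" "(j, x) \<in> I" "(k, y) \<in> I" "p \<noteq> q"
      by (cases p, cases q) auto
    show "b = c"
    proof (cases "j = k")
      case True
      have "d = G j" if "d \<in> L" "p \<in> d" "q \<in> d" for d
        using that pq True unfolding L_def G_def A_def by auto
      then show ?thesis using bc by blast
    next
      case False
      have lt: "j < 7" "k < 7" using pq unfolding I_def by auto
      have "\<exists>a b. a \<in> {0..<int m} \<and> b \<in> {0..<int m} \<and> d = A a b \<and>
          (a + b * int j) mod int m = x mod int m \<and> (a + b * int k) mod int m = y mod int m"
        if d: "d \<in> L" "p \<in> d" "q \<in> d" for d
      proof -
        obtain a b where ab: "a \<in> {0..<int m}" "b \<in> {0..<int m}" "d = A a b"
          using d pq False unfolding L_def G_def by auto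
        then have "(a + b * int j) mod int m = x" "(a + b * int k) mod int m = y"
          using d pq unfolding A_def by auto
        then show ?thesis using ab by (metis mod_mod_trivial)
      qed
      then obtain a a' e e' where ae: "a \<in> {0..<int m}" "a' \<in> {0..<int m}" "b = A a a'"
          "(a + a' * int j) mod int m = x mod int m" "(a + a' * int k) mod int m = y mod int m"
          "e \<in> {0..<int m}" "e' \<in> {0..<int m}" "c = A e e'"
          "(e + e' * int j) mod int m = x mod int m" "(e + e' * int k) mod int m = y mod int m"
        using bc by metis
      have "\<exists>!p. fst p \<in> {0..<int m} \<and> snd p \<in> {0..<int m} \<and>
          (fst p + snd p * int j) mod int m = x mod int m \<and> (fst p + snd p * int k) mod int m = y mod int m"
        by (rule affine_line_unique[OF m' lt False cop])
      then have "(a, a') = (e, e')" using ae by (elim ex1E) (metis fst_conv snd_conv)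
      then show ?thesis using ae by simp
    qed
  qed
  then have "GDD45_with5 (card I)"
  proof (rule GDD45_pbd[OF _ finI])
    show "G 0 \<in> L" using s(1)[of 0] m unfolding L_def by auto
    show "GDD45_with5 (card (G 0))"
      using m5 s(1)[of 0] by (simp add: G_def card_cartesian_product_singleton card_image)
  qed (use gdd in auto)
  then show ?thesis by (simp add: cardI)
qed

section \<open>Difference families\<close>

text \<open>The points are the pairs \<open>(x, a)\<close> with \<open>0 \<le> x < n\<close> and \<open>0 \<le> a < c\<close>, and the integers modulo \<open>n\<close> act on
  the first component. Two points lie in the same group iff their first components agree modulo \<open>m\<close> and
  their second components have the same quotient by \<open>q\<close>. For \<open>n = 1\<close> the action is trivial and the base
  blocks are all the blocks.\<close>

definition shift :: "int \<Rightarrow> int \<Rightarrow> int \<times> int \<Rightarrow> int \<times> int" where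
  "shift n t p = ((fst p + t) mod n, snd p)"

definition develop :: "int \<Rightarrow> (int \<times> int) list list \<Rightarrow> (int \<times> int) set set" where
  "develop n bs = {shift n t ` set b |b t. b \<in> set bs \<and> t \<in> {0..<n}}"

definition differences :: "int \<Rightarrow> (int \<times> int) list list \<Rightarrow> int \<Rightarrow> (int \<times> int) list" where
  "differences n bs a =
     [(snd q, (fst q - fst p) mod n). b \<leftarrow> bs, p \<leftarrow> b, snd p = a, q \<leftarrow> b, q \<noteq> p]"

definition admissible :: "int \<Rightarrow> int \<Rightarrow> int \<Rightarrow> int \<times> int \<Rightarrow> bool" where
  "admissible m q a bd \<longleftrightarrow> snd bd mod m \<noteq> 0 \<or> a div q \<noteq> fst bd div q"

text \<open>The defining property, every admissible difference exactly once in each row, is put in a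
  form that evaluates: the list of differences has no repetition, contains admissible entries only,
  and has as many entries as there are admissible pairs. The block lengths in \<open>K\<close> are
  checked together with it.\<close>

definition difference_family ::
  "nat list \<Rightarrow> int \<Rightarrow> int \<Rightarrow> int \<Rightarrow> int \<Rightarrow> (int \<times> int) list list \<Rightarrow> bool" where
  "difference_family K n c m q bs \<longleftrightarrow>
     list_all (\<lambda>b. distinct b \<and> length b \<in> set K \<and> list_all (\<lambda>(x, a). 0 \<le> x \<and> x < n \<and> 0 \<le> a \<and> a < c) b) bs \<and>
     list_all (\<lambda>a. let ds = differences n bs a in
       distinct ds \<and> list_all (admissible m q a) ds \<and>
       length ds = length (filter (admissible m q a) (List.product [0..c - 1] [0..n - 1]))) [0..c - 1]"

definition gdd_graph :: "int \<Rightarrow> int \<Rightarrow> int \<Rightarrow> int \<Rightarrow> ((int \<times> int) \<times> (int \<times> int)) set" where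
  "gdd_graph n c m q = {((x, a), (y, b)). x \<in> {0..<n} \<and> y \<in> {0..<n} \<and> a \<in> {0..<c} \<and> b \<in> {0..<c} \<and>
     (x mod m \<noteq> y mod m \<or> a div q \<noteq> b div q)}"

text \<open>An edge from \<open>p\<close> to \<open>r\<close> has an admissible difference, which
  occurs for exactly one pair of points in one base block; the translation that carries this pair to
  \<open>p\<close> and \<open>r\<close> is then determined. So exactly one translate covers the
  edge.\<close>

lemma difference_family_decomposes:
  assumes df: "difference_family K n c m q bs" and n: "n > 0" "m dvd n"
  shows "decomposes (set K) (gdd_graph n c m q) (develop n bs)"
    and "b0 \<in> set bs \<Longrightarrow> \<exists>S\<in>develop n bs. card S = length b0"
proof -
  let ?X = "{0..<n} \<times> {0..<c}"
  define \<phi> :: "(int \<times> int) list \<times> (int \<times> int) \<times> (int \<times> int) \<Rightarrow> int \<times> int"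
    where "\<phi> = (\<lambda>(b, p, q). (snd q, (fst q - fst p) mod n))"
  define \<Omega> where "\<Omega> a = [(b, p, q). b \<leftarrow> bs, p \<leftarrow> b, snd p = a, q \<leftarrow> b, q \<noteq> p]" for a
  have set_\<Omega>: "set (\<Omega> a) = {(b, p, q). b \<in> set bs \<and> p \<in> set b \<and> snd p = a \<and> q \<in> set b \<and> q \<noteq> p}" for a
    unfolding \<Omega>_def by auto
  have diffs: "differences n bs a = map \<phi> (\<Omega> a)" for a
    unfolding differences_def \<Omega>_def \<phi>_def
    by (simp add: map_concat comp_def if_distrib[of "map _"] cong: if_cong)
  have bs: "distinct b" "length b \<in> set K" "set b \<subseteq> ?X" if "b \<in> set bs" for b
    using df that unfolding difference_family_def list_all_iff by fastforce+
  have row: "distinct (differences n bs a)" "\<And>d. d \<in> set (differences n bs a) \<Longrightarrow> admissible m q a d"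
      "length (differences n bs a) = length (filter (admissible m q a) (List.product [0..c - 1] [0..n - 1]))"
    if "a \<in> {0..<c}" for a
  proof -
    have "a \<in> set [0..c - 1]" using that by simp
    then have "let ds = differences n bs a in
       distinct ds \<and> list_all (admissible m q a) ds \<and>
       length ds = length (filter (admissible m q a) (List.product [0..c - 1] [0..n - 1]))"
      using df unfolding difference_family_def list_all_iff by blast
    then show "distinct (differences n bs a)" "\<And>d. d \<in> set (differences n bs a) \<Longrightarrow> admissible m q a d"
      "length (differences n bs a) = length (filter (admissible m q a) (List.product [0..c - 1] [0..n - 1]))"
      by (simp_all add: Let_def list_all_iff)
  qed
  have inj: "inj_on \<phi> (set (\<Omega> a))" if "a \<in> {0..<c}" for a
    using row(1)[OF that] unfolding diffs distinct_map by blast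
  have cover: "\<phi> ` set (\<Omega> a) = {d \<in> {0..<c} \<times> {0..<n}. admissible m q a d}" if a: "a \<in> {0..<c}" for a
  proof -
    let ?D = "filter (admissible m q a) (List.product [0..c - 1] [0..n - 1])"
    have D: "set ?D = {d \<in> {0..<c} \<times> {0..<n}. admissible m q a d}" by auto
    have "\<phi> ` set (\<Omega> a) = set (differences n bs a)" by (simp add: diffs)
    also have "\<dots> = set ?D"
    proof (rule card_subset_eq)
      have "\<phi> w \<in> {0..<c} \<times> {0..<n}" if "w \<in> set (\<Omega> a)" for w
        using that bs n unfolding set_\<Omega> \<phi>_def by fastforce
      then have "set (differences n bs a) \<subseteq> {0..<c} \<times> {0..<n}"
        unfolding diffs set_map by (rule image_subsetI)
      then show "set (differences n bs a) \<subseteq> set ?D"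
        using row(2)[OF a] unfolding D by blast
      have "distinct ?D" by (intro distinct_filter distinct_product distinct_upto)
      then show "card (set (differences n bs a)) = card (set ?D)"
        using row(1,3)[OF a] by (simp only: distinct_card)
    qed simp
    finally show ?thesis by (simp only: D)
  qed
  \<comment> \<open>Because \<open>m\<close> divides \<open>n\<close>, the residue modulo
    \<open>m\<close> survives the reduction modulo \<open>n\<close>; hence lying in a common group
    depends only on the rows and the difference.\<close>
  have adm: "admissible m q a (b, (y - x) mod n) \<longleftrightarrow> x mod m \<noteq> y mod m \<or> a div q \<noteq> b div q" for a b x y
  proof -
    have "(y - x) mod n mod m = (y - x) mod m" using n(2) by (rule mod_mod_cancel)
    moreover have "(y - x) mod m = 0 \<longleftrightarrow> x mod m = y mod m"
      by (metis mod_eq_0_iff_dvd mod_eq_dvd_iff)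
    ultimately show ?thesis unfolding admissible_def by simp
  qed
  have shift_X: "shift n t p \<in> ?X" if "p \<in> ?X" for t p
    using that n unfolding shift_def by auto
  have shift_diff: "(fst (shift n t q) - fst (shift n t p)) mod n = (fst q - fst p) mod n" for t p q
    unfolding shift_def by (simp add: mod_diff_eq)
  have graph: "(p, r) \<in> gdd_graph n c m q \<longleftrightarrow> p \<in> ?X \<and> r \<in> ?X \<and> admissible m q (snd p) (snd r, (fst r - fst p) mod n)"
    for p r unfolding adm gdd_graph_def by auto
  have pair: "(shift n t p, shift n t r) \<in> gdd_graph n c m q"
    if "b \<in> set bs" "p \<in> set b" "r \<in> set b" "p \<noteq> r" for b p r t
  proof -
    have X: "p \<in> ?X" "r \<in> ?X" using bs(3) that by blast+
    have "snd p \<in> {0..<c}" using X by auto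
    moreover have "(b, p, r) \<in> set (\<Omega> (snd p))" using that unfolding set_\<Omega> by auto
    ultimately have "\<phi> (b, p, r) \<in> {d \<in> {0..<c} \<times> {0..<n}. admissible m q (snd p) d}"
      using cover by blast
    then show ?thesis
      unfolding graph shift_diff using shift_X X by (auto simp: \<phi>_def shift_def)
  qed
  have irrefl: "(p, p) \<notin> gdd_graph n c m q" for p unfolding gdd_graph_def by auto
  \<comment> \<open>Distinct points of a base block have adjacent translates, and the graph has no
    loops, so translation is injective on the block.\<close>
  have card_shift: "card (shift n t ` set b) = length b" if b: "b \<in> set bs" for b t
  proof -
    have "inj_on (shift n t) (set b)"
    proof (rule inj_onI, rule ccontr)
      fix p r assume "p \<in> set b" "r \<in> set b" "shift n t p = shift n t r" "p \<noteq> r"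
      then show False using pair[OF b, of p r t] irrefl[of "shift n t r"] by simp
    qed
    then show ?thesis using bs[OF b] by (simp add: card_image distinct_card)
  qed
  show "\<exists>S\<in>develop n bs. card S = length b0" if "b0 \<in> set bs"
  proof
    show "card (shift n 0 ` set b0) = length b0" using that by (rule card_shift)
    show "shift n 0 ` set b0 \<in> develop n bs" using that n unfolding develop_def by auto
  qed
  show "decomposes (set K) (gdd_graph n c m q) (develop n bs)"
  proof (rule decomposesI)
    fix S assume "S \<in> develop n bs"
    then obtain b t where b: "b \<in> set bs" "S = shift n t ` set b" unfolding develop_def by blast
    show "card S \<in> set K" using bs[OF b(1)] by (simp add: b(2) card_shift[OF b(1)])
    show "finite S" by (simp add: b(2))
    show "arcs S \<subseteq> gdd_graph n c m q" using pair[OF b(1)] unfolding arcs_def b(2) by blast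
  next
    fix p r assume pr: "(p, r) \<in> gdd_graph n c m q"
    have X: "p \<in> ?X" "r \<in> ?X" and "admissible m q (snd p) (snd r, (fst r - fst p) mod n)"
      using pr unfolding graph by auto
    then have "(snd r, (fst r - fst p) mod n) \<in> \<phi> ` set (\<Omega> (snd p))"
      using cover[of "snd p"] n by auto
    then obtain w where w0: "w \<in> set (\<Omega> (snd p))" "(snd r, (fst r - fst p) mod n) = \<phi> w" by blast
    obtain b p' r' where "w = (b, p', r')" by (cases w) auto
    with w0 have w: "b \<in> set bs" "p' \<in> set b" "r' \<in> set b" "snd p' = snd p" "snd r' = snd r"
        "(fst r' - fst p') mod n = (fst r - fst p) mod n"
      unfolding set_\<Omega> \<phi>_def by auto
    \<comment> \<open>The translation taking \<open>p'\<close> to \<open>p\<close>; as the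
      differences agree, it takes \<open>r'\<close> to \<open>r\<close> as well.\<close>
    define t where "t = (fst p - fst p') mod n"
    have "shift n t p' = p" using X w unfolding shift_def t_def
      by (simp add: mod_add_right_eq prod_eq_iff) auto
    moreover have "shift n t r' = r"
    proof -
      have "(fst r' + t) mod n = ((fst r' - fst p') mod n + fst p) mod n"
        unfolding t_def by (simp add: mod_simps algebra_simps)
      also have "\<dots> = fst r" using X unfolding w(6) by (auto simp: mod_simps)
      finally show ?thesis using w by (simp add: shift_def prod_eq_iff)
    qed
    moreover have "t \<in> {0..<n}" using n unfolding t_def by simp
    then have "shift n t ` set b \<in> develop n bs" using w unfolding develop_def by blast
    ultimately show "p \<noteq> r \<and> (\<exists>S\<in>develop n bs. p \<in> S \<and> r \<in> S)"
      using pr irrefl w by blast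
  next
    fix p r S S'
    assume pr: "(p, r) \<in> gdd_graph n c m q" and S: "S \<in> develop n bs" "S' \<in> develop n bs"
      "p \<in> S" "r \<in> S" "p \<in> S'" "r \<in> S'"
    have ne: "p \<noteq> r" and X: "snd p \<in> {0..<c}" using pr irrefl unfolding graph by auto
    have repr: "\<exists>b t p' r'. b \<in> set bs \<and> t \<in> {0..<n} \<and> T = shift n t ` set b \<and>
        p = shift n t p' \<and> (b, p', r') \<in> set (\<Omega> (snd p)) \<and>
        \<phi> (b, p', r') = (snd r, (fst r - fst p) mod n) \<and> p' \<in> ?X"
      if T: "T \<in> develop n bs" "p \<in> T" "r \<in> T" for T
    proof -
      obtain b t where b: "b \<in> set bs" "t \<in> {0..<n}" "T = shift n t ` set b"
        using T(1) unfolding develop_def by blast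
      then obtain p' r' where p': "p' \<in> set b" "r' \<in> set b" "p = shift n t p'" "r = shift n t r'"
        using T by blast
      then have "(b, p', r') \<in> set (\<Omega> (snd p))" using b ne unfolding set_\<Omega> by (auto simp: shift_def)
      moreover have "\<phi> (b, p', r') = (snd r, (fst r - fst p) mod n)"
        unfolding \<phi>_def p'(3,4) shift_diff by (simp add: shift_def)
      moreover have "p' \<in> ?X" using bs(3)[OF b(1)] p'(1) by blast
      ultimately show ?thesis using b p' by blast
    qed
    obtain b t p1 r1 where 1: "t \<in> {0..<n}" "S = shift n t ` set b" "p = shift n t p1"
        "(b, p1, r1) \<in> set (\<Omega> (snd p))" "\<phi> (b, p1, r1) = (snd r, (fst r - fst p) mod n)"
      using repr[OF S(1,3,4)] by blast
    obtain b' t' p2 r2 where 2: "t' \<in> {0..<n}" "S' = shift n t' ` set b'" "p = shift n t' p2"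
        "(b', p2, r2) \<in> set (\<Omega> (snd p))" "\<phi> (b', p2, r2) = (snd r, (fst r - fst p) mod n)"
      using repr[OF S(2,5,6)] by blast
    have "(b, p1, r1) = (b', p2, r2)"
      using inj_onD[OF inj[OF X] _ 1(4) 2(4)] 1(5) 2(5) by simp
    then have eq: "b = b'" "p1 = p2" by auto
    have "(fst p1 + t) mod n = (fst p1 + t') mod n"
      using 1(3) 2(3) unfolding shift_def eq by (metis fst_conv)
    then have "t mod n = t' mod n" by (metis add_diff_cancel_left' mod_diff_left_eq)
    then have "t = t'" using 1(1) 2(1) by simp
    then show "S = S'" using 1(2) 2(2) eq by simp
  qed
qed

text \<open>Mixed-radix numbering: the pair \<open>x mod m\<close>, \<open>a div q\<close> names the
  group and the pair \<open>x div m\<close>, \<open>a mod q\<close> the position in it. For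
  \<open>n = m * s\<close> and \<open>c = k * q\<close> this gives \<open>m * k\<close> groups of
  \<open>s * q\<close> points each.\<close>

definition to_groups :: "int \<Rightarrow> int \<Rightarrow> int \<Rightarrow> int \<times> int \<Rightarrow> nat \<times> nat" where
  "to_groups m k q p = (nat ((fst p mod m) * k + snd p div q), nat ((fst p div m) * q + snd p mod q))"

lemma mult_add_less:
  fixes x y a b :: int
  assumes "0 \<le> x" "x < a" "0 \<le> y" "y < b"
  shows "0 \<le> x * b + y" "x * b + y < a * b"
proof -
  show "0 \<le> x * b + y" using assms by simp
  have "x * b + y < (x + 1) * b" using assms by (simp add: algebra_simps)
  also have "\<dots> \<le> a * b" using assms by (intro mult_right_mono) auto
  finally show "x * b + y < a * b" .
qed

lemma mult_add_inj:
  fixes x y b :: int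
  assumes "x * b + y = x' * b + y'" "0 \<le> y" "y < b" "0 \<le> y'" "y' < b"
  shows "x = x'" "y = y'"
proof -
  have "(x * b + y) div b = x" "(x' * b + y') div b = x'"
    using assms(2-5) by simp_all
  then show "x = x'" using assms(1) by simp
  then show "y = y'" using assms(1) by simp
qed

lemma div_less_of_less_mult:
  fixes x a b :: int
  assumes "x < a * b" "0 < b"
  shows "x div b < a"
proof -
  have "x div b * b \<le> x" using assms(2) by (simp add: pos_mod_sign flip: minus_mod_eq_div_mult)
  then have "x div b * b < a * b" using assms(1) by simp
  then show ?thesis using assms(2) by simp
qed

context
  fixes n c m q k s :: int
  assumes pos: "m > 0" "k > 0" "q > 0" "s > 0" and n: "n = m * s" and c: "c = k * q"
begin

lemma to_groups_range:
  assumes "x \<in> {0..<n}" "a \<in> {0..<c}"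
  shows "0 \<le> x mod m" "x mod m < m" "0 \<le> a div q" "a div q < k"
    "0 \<le> x div m" "x div m < s" "0 \<le> a mod q" "a mod q < q"
  using assms pos n c
  by (auto simp: pos_imp_zdiv_nonneg_iff intro!: div_less_of_less_mult simp: mult.commute)

lemma fst_to_groups_eq:
  assumes "x \<in> {0..<n}" "a \<in> {0..<c}" "y \<in> {0..<n}" "b \<in> {0..<c}"
  shows "fst (to_groups m k q (x, a)) = fst (to_groups m k q (y, b)) \<longleftrightarrow>
    x mod m = y mod m \<and> a div q = b div q"
proof -
  note r = to_groups_range[OF assms(1,2)] to_groups_range[OF assms(3,4)]
  have "0 \<le> x mod m * k + a div q" "0 \<le> y mod m * k + b div q"
    using mult_add_less(1) r by blast+
  then have "fst (to_groups m k q (x, a)) = fst (to_groups m k q (y, b)) \<longleftrightarrow>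
      x mod m * k + a div q = y mod m * k + b div q"
    unfolding to_groups_def by (simp add: eq_nat_nat_iff)
  then show ?thesis using mult_add_inj[of "x mod m" k "a div q" "y mod m" "b div q"] r by auto
qed

lemma inj_to_groups: "inj_on (to_groups m k q) ({0..<n} \<times> {0..<c})"
proof (rule inj_onI, clarify)
  fix x a y b
  assume *: "x \<in> {0..<n}" "a \<in> {0..<c}" "y \<in> {0..<n}" "b \<in> {0..<c}"
    and eq: "to_groups m k q (x, a) = to_groups m k q (y, b)"
  note r = to_groups_range[OF *(1,2)] to_groups_range[OF *(3,4)]
  have 1: "x mod m = y mod m" "a div q = b div q" using fst_to_groups_eq[OF *] arg_cong[OF eq, of fst] by blast+
  have "0 \<le> x div m * q + a mod q" "0 \<le> y div m * q + b mod q"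
    using mult_add_less(1) r by blast+
  moreover have "nat (x div m * q + a mod q) = nat (y div m * q + b mod q)"
    using eq unfolding to_groups_def by simp
  ultimately have "x div m * q + a mod q = y div m * q + b mod q" by (simp add: eq_nat_nat_iff)
  then have 2: "x div m = y div m" "a mod q = b mod q"
    using mult_add_inj[of "x div m" q "a mod q" "y div m" "b mod q"] r by auto
  show "x = y \<and> a = b" using 1 2 by (metis div_mult_mod_eq)
qed

text \<open>Surjectivity by counting: the map is injective and both sides have
  \<open>m * k * s * q\<close> elements.\<close>

lemma to_groups_image:
  "to_groups m k q ` ({0..<n} \<times> {0..<c}) = {..<nat (m * k)} \<times> {..<nat (s * q)}"
proof (rule card_subset_eq)
  show "to_groups m k q ` ({0..<n} \<times> {0..<c}) \<subseteq> {..<nat (m * k)} \<times> {..<nat (s * q)}"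
  proof
    fix w assume "w \<in> to_groups m k q ` ({0..<n} \<times> {0..<c})"
    then obtain x a where *: "x \<in> {0..<n}" "a \<in> {0..<c}" and w: "w = to_groups m k q (x, a)" by blast
    note r = to_groups_range[OF *]
    show "w \<in> {..<nat (m * k)} \<times> {..<nat (s * q)}"
      using mult_add_less[OF r(1-4)] mult_add_less[OF r(5-8)] unfolding to_groups_def w
      by (simp add: nat_less_eq_zless)
  qed
  show "card (to_groups m k q ` ({0..<n} \<times> {0..<c})) = card ({..<nat (m * k)} \<times> {..<nat (s * q)})"
    unfolding card_image[OF inj_to_groups]
    using pos by (simp add: card_cartesian_product n c nat_mult_distrib)
qed simp

lemma to_groups_graph:
  "map_prod (to_groups m k q) (to_groups m k q) ` gdd_graph n c m q = multipartite {..<nat (m * k)} (nat (s * q))"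
    (is "?L = ?R")
proof
  let ?f = "to_groups m k q"
  have f: "?f (x, a) \<in> {..<nat (m * k)} \<times> {..<nat (s * q)}" if "x \<in> {0..<n}" "a \<in> {0..<c}" for x a
    using that to_groups_image by blast
  show "?L \<subseteq> ?R"
  proof
    fix e assume "e \<in> ?L"
    then obtain w where "e = map_prod ?f ?f w" "w \<in> gdd_graph n c m q" by (rule imageE)
    moreover obtain x a y b where "w = ((x, a), (y, b))"
      by (cases w, cases "fst w", cases "snd w") auto
    ultimately have *: "((x, a), (y, b)) \<in> gdd_graph n c m q"
      and e: "e = map_prod ?f ?f ((x, a), (y, b))" by simp_all
    from * have "x \<in> {0..<n}" "a \<in> {0..<c}" "y \<in> {0..<n}" "b \<in> {0..<c}"
        "x mod m \<noteq> y mod m \<or> a div q \<noteq> b div q"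
      unfolding gdd_graph_def by auto
    then show "e \<in> ?R"
      unfolding e map_prod_simp
      using f[of x a] f[of y b] fst_to_groups_eq[of x a y b]
      by (cases "?f (x, a)"; cases "?f (y, b)") auto
  qed
  show "?R \<subseteq> ?L"
  proof
    fix e assume "e \<in> ?R"
    then obtain g h g' h' where e: "e = ((g, h), (g', h'))" "g \<noteq> g'"
        "(g, h) \<in> {..<nat (m * k)} \<times> {..<nat (s * q)}" "(g', h') \<in> {..<nat (m * k)} \<times> {..<nat (s * q)}"
      by (auto simp: multipartite_def)
    then obtain p r where p: "p \<in> {0..<n} \<times> {0..<c}" "(g, h) = ?f p" "r \<in> {0..<n} \<times> {0..<c}" "(g', h') = ?f r"
      unfolding to_groups_image[symmetric] by (elim imageE)
    obtain x a y b where xa: "p = (x, a)" "r = (y, b)" by (cases p, cases r)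
    have "fst (?f (x, a)) \<noteq> fst (?f (y, b))" using p xa e(2) by (metis fst_conv)
    then have "(p, r) \<in> gdd_graph n c m q"
      using p fst_to_groups_eq[of x a y b] unfolding xa gdd_graph_def by auto
    then show "e \<in> ?L" using p e by (intro image_eqI[of _ _ "(p, r)"]) auto
  qed
qed

end

lemma gdd_graph_subset: "gdd_graph n c m q \<subseteq> ({0..<n} \<times> {0..<c}) \<times> ({0..<n} \<times> {0..<c})"
  unfolding gdd_graph_def by auto

section \<open>Small designs\<close>

lemma GDD45_cyclic:
  assumes df: "difference_family [4, 5] n c m q bs" and pos: "m > 0" "k > 0" "q > 0" "s > 0"
    and eq: "n = m * s" "c = k * q" "s * q = 4"
  shows "GDD45 (nat (m * k))"
    and "\<exists>b\<in>set bs. length b = 5 \<Longrightarrow> GDD45_with5 (nat (m * k))"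
proof -
  have n: "n > 0" "m dvd n" using eq pos by simp_all
  let ?f = "to_groups m k q"
  have f: "inj_on ?f ({0..<n} \<times> {0..<c})" by (rule inj_to_groups[OF pos eq(1,2)])
  note dec = difference_family_decomposes(1)[OF df n]
  have "decomposes (set [4, 5]) (multipartite {..<nat (m * k)} (nat (s * q))) ((`) ?f ` develop n bs)"
    unfolding to_groups_graph[OF pos eq(1,2), symmetric]
    using decomposes_subset[OF dec gdd_graph_subset]
    by (intro decomposes_image[OF dec f gdd_graph_subset]) auto
  then have dec': "decomposes {4, 5} (multipartite {..<nat (m * k)} 4) ((`) ?f ` develop n bs)"
    by (simp add: eq(3))
  then show "GDD45 (nat (m * k))" unfolding GDD45_def by blast
  assume "\<exists>b\<in>set bs. length b = 5"
  then obtain S where S: "S \<in> develop n bs" "card S = 5"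
    using difference_family_decomposes(2)[OF df n] by metis
  have "card (?f ` S) = 5"
    using S card_image[OF inj_on_subset[OF f decomposes_subset[OF dec gdd_graph_subset _ _ S(1)]]] by simp
  then show "GDD45_with5 (nat (m * k))" using dec' S(1) unfolding GDD45_with5_def by blast
qed

definition trivial_orbits :: "int list list \<Rightarrow> (int \<times> int) list list" where
  "trivial_orbits = map (map (Pair 0))"

lemma develop_trivial_orbits: "develop 1 (trivial_orbits bs) = (`) (Pair 0) ` set ` set bs"
proof -
  have "{0..<1::int} = {0}" by auto
  then have "develop 1 (trivial_orbits bs) = (\<lambda>b. shift 1 0 ` set b) ` set (trivial_orbits bs)"
    unfolding develop_def by auto
  also have "\<dots> = (`) (Pair 0) ` set ` set bs"
    unfolding trivial_orbits_def by (simp add: image_image shift_def)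
  finally show ?thesis .
qed

text \<open>As \<open>Pair 0\<close> is injective, intersections can be computed on the integer
  lists; blocks are compared as sets, so the order of the entries does not matter.\<close>

lemma three_way_lists:
  assumes df: "difference_family [4] 1 c 1 q (trivial_orbits b1)" "difference_family [4] 1 c 1 q (trivial_orbits b2)"
      "difference_family [4] 1 c 1 q (trivial_orbits b3)"
    and pos: "q > 0" "k > 0" and c: "c = k * q"
    and int: "set ` set b1 \<inter> set ` set b2 = set ` set b1 \<inter> set ` set b3"
      "set ` set b1 \<inter> set ` set b3 = set ` set b2 \<inter> set ` set b3"
      "card (set ` set b1 - set ` set b2) = d"
  shows "three_way (multipartite {..<nat k} (nat q)) d"
proof -
  let ?g = "(`) (Pair (0::int)) :: int set \<Rightarrow> _"
  have dec: "decomposes {4} (gdd_graph 1 c 1 q) (?g ` set ` set bs)"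
    if "difference_family [4] 1 c 1 q (trivial_orbits bs)" for bs
    using difference_family_decomposes(1)[OF that] unfolding develop_trivial_orbits by simp
  have "inj (Pair (0::int) :: int \<Rightarrow> _)" by (rule injI) simp
  then have g: "inj ?g" by (intro injI) (simp add: inj_image_eq_iff)
  have "card (?g ` set ` set b1 - ?g ` set ` set b2) = d"
    using int(3) g by (simp add: card_image inj_on_subset flip: image_set_diff[OF g])
  then have "three_way (gdd_graph 1 c 1 q) d"
    using dec[OF df(1)] dec[OF df(2)] dec[OF df(3)] int(1,2) unfolding three_way_def
    by (metis image_Int[OF g])
  moreover have "inj_on (to_groups 1 k q) ({0..<1} \<times> {0..<c})"
    by (rule inj_to_groups[where s = 1]) (use pos c in auto)
  moreover have "map_prod (to_groups 1 k q) (to_groups 1 k q) ` gdd_graph 1 c 1 q = multipartite {..<nat k} (nat q)"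
    using to_groups_graph[of 1 k q 1 1 c] pos c by simp
  ultimately show ?thesis using three_way_image[OF _ gdd_graph_subset] by metis
qed

text \<open>The base blocks below were found by computer search, except for \<open>u = 4\<close> and \<open>u = 5\<close> (transversal
  designs over the field with 4 elements) and \<open>u = 10\<close>.\<close>

lemma GDD45_4: "GDD45 4"
proof -
  have "difference_family [4, 5] 1 16 1 4 (
    trivial_orbits [[0, 4, 8, 12], [0, 5, 9, 14], [0, 6, 10, 15], [0, 7, 11, 13], [1, 4, 9, 13],
    [1, 5, 8, 15], [1, 6, 11, 14], [1, 7, 10, 12], [2, 4, 10, 14], [2, 5, 11, 12], [2, 6, 8, 13],
    [2, 7, 9, 15], [3, 4, 11, 15], [3, 5, 10, 13], [3, 6, 9, 12], [3, 7, 8, 14]])"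
    by code_simp
  from GDD45_cyclic(1)[OF this, where k = 4 and s = 1]
  show ?thesis by (simp)
qed

lemma GDD45_with5_5: "GDD45_with5 5"
proof -
  have "difference_family [4, 5] 1 20 1 4 (
    trivial_orbits [[0, 4, 8, 12, 16], [0, 5, 9, 14, 19], [0, 6, 10, 15, 17], [0, 7, 11, 13, 18],
    [1, 4, 9, 13, 17], [1, 5, 8, 15, 18], [1, 6, 11, 14, 16], [1, 7, 10, 12, 19], [2, 4, 10, 14, 18],
    [2, 5, 11, 12, 17], [2, 6, 8, 13, 19], [2, 7, 9, 15, 16], [3, 4, 11, 15, 19], [3, 5, 10, 13, 16],
    [3, 6, 9, 12, 18], [3, 7, 8, 14, 17]])"
    by code_simp
  from GDD45_cyclic(2)[OF this, where k = 5 and s = 1]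
  show ?thesis by (simp add: trivial_orbits_def)
qed

lemma GDD45_with5_6: "GDD45_with5 6"
proof -
  have "difference_family [4, 5] 24 1 6 1 (
    [[(0, 0), (1, 0), (3, 0), (11, 0), (20, 0)]])"
    by code_simp
  from GDD45_cyclic(2)[OF this, where k = 1 and s = 4]
  show ?thesis by (simp)
qed

text \<open>With \<open>c\<close> rows on \<open>4 u\<close> points, \<open>i\<close> base blocks of
  size 4 and \<open>j\<close> of size 5, counting differences gives
  \<open>3 i + 5 j = c (u - 1)\<close>. For \<open>u = 7\<close>, one row (6) and two rows (12)
  force \<open>j = 0\<close>, whereas four rows allow \<open>i = j = 3\<close>. The same count rules
  out a single row with a block of size 5 for \<open>u\<close> = 8, 10 and 13.\<close>

lemma GDD45_with5_7: "GDD45_with5 7"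
proof -
  have "difference_family [4, 5] 7 4 7 4 (
    [[(0, 0), (1, 0), (6, 2), (2, 2), (4, 3)], [(0, 0), (2, 0), (5, 1), (4, 1)], [(0, 0), (3, 0),
    (2, 3), (1, 3)], [(0, 0), (1, 1), (6, 1), (3, 2), (4, 2)], [(0, 1), (3, 1), (4, 3), (6, 3)],
    [(0, 1), (1, 2), (6, 2), (5, 3), (2, 3)]])"
    by code_simp
  from GDD45_cyclic(2)[OF this, where k = 1 and s = 1]
  show ?thesis by (simp)
qed

lemma GDD45_with5_8: "GDD45_with5 8"
proof -
  have "difference_family [4, 5] 16 2 8 2 (
    [[(0, 0), (1, 0), (10, 0), (12, 0), (7, 1)], [(0, 0), (3, 0), (12, 1), (2, 1)], [(0, 0), (1, 1),
    (3, 1), (4, 1)], [(0, 0), (5, 1), (14, 1), (10, 1)]])"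
    by code_simp
  from GDD45_cyclic(2)[OF this, where k = 1 and s = 2]
  show ?thesis by (simp)
qed

lemma GDD45_with5_9: "GDD45_with5 9"
proof -
  have "difference_family [4, 5] 18 2 9 2 (
    [[(0, 0), (1, 0), (3, 0), (13, 0), (15, 1)], [(0, 0), (4, 0), (17, 1), (7, 1)], [(0, 0), (7, 0),
    (5, 1), (8, 1)], [(0, 0), (4, 1), (11, 1), (10, 1), (6, 1)]])"
    by code_simp
  from GDD45_cyclic(2)[OF this, where k = 1 and s = 2]
  show ?thesis by (simp)
qed

text \<open>The cyclic \<open>S(2,5,41)\<close> with base blocks \<open>{0,1,4,11,29}\<close> and \<open>{0,2,8,17,22}\<close> without the point 0,
  relabelled so that the lines through 0 become \<open>{4i,...,4i+3}\<close>.\<close>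

lemma GDD45_with5_10: "GDD45_with5 10"
proof -
  have "difference_family [4, 5] 1 40 1 4 (
    trivial_orbits [[0, 4, 9, 20, 28], [0, 5, 22, 29, 33], [0, 6, 12, 19, 25], [0, 7, 8, 16, 32],
    [0, 10, 24, 31, 35], [0, 11, 17, 27, 37], [0, 13, 26, 34, 36], [0, 14, 18, 23, 38],
    [0, 15, 21, 30, 39], [1, 4, 25, 30, 36], [1, 5, 8, 14, 39], [1, 6, 22, 26, 38], [1, 7, 10, 13, 19],
    [1, 9, 18, 27, 32], [1, 11, 15, 23, 35], [1, 12, 16, 31, 33], [1, 17, 20, 24, 29],
    [1, 21, 28, 34, 37], [2, 4, 19, 23, 37], [2, 5, 18, 24, 34], [2, 6, 14, 20, 35], [2, 7, 11, 26, 29],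
    [2, 8, 12, 21, 27], [2, 9, 15, 31, 36], [2, 10, 22, 30, 32], [2, 13, 16, 28, 38],
    [2, 17, 25, 33, 39], [3, 4, 11, 33, 38], [3, 5, 13, 27, 30], [3, 6, 18, 31, 39], [3, 7, 15, 20, 25],
    [3, 8, 23, 24, 36], [3, 9, 19, 22, 34], [3, 10, 14, 17, 28], [3, 12, 29, 32, 37],
    [3, 16, 21, 26, 35], [4, 8, 17, 26, 31], [4, 10, 12, 34, 39], [4, 13, 18, 29, 35],
    [4, 14, 21, 24, 32], [4, 15, 16, 22, 27], [5, 9, 25, 35, 37], [5, 10, 16, 20, 36],
    [5, 11, 19, 21, 31], [5, 12, 23, 26, 28], [5, 15, 17, 32, 38], [6, 8, 15, 29, 34],
    [6, 9, 13, 17, 21], [6, 10, 23, 27, 33], [6, 11, 28, 32, 36], [6, 16, 24, 30, 37],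
    [7, 9, 12, 24, 38], [7, 14, 22, 31, 37], [7, 17, 23, 30, 34], [7, 18, 21, 33, 36],
    [7, 27, 28, 35, 39], [8, 13, 20, 33, 37], [8, 18, 22, 25, 28], [8, 19, 30, 35, 38],
    [9, 14, 26, 30, 33], [9, 16, 23, 29, 39], [10, 15, 18, 26, 37], [10, 21, 25, 29, 38],
    [11, 12, 18, 20, 30], [11, 13, 22, 24, 39], [11, 14, 16, 25, 34], [12, 17, 22, 35, 36],
    [13, 23, 25, 31, 32], [14, 19, 27, 29, 36], [15, 19, 24, 28, 33], [19, 20, 26, 32, 39],
    [20, 27, 31, 34, 38]])"
    by code_simp
  from GDD45_cyclic(2)[OF this, where k = 10 and s = 1]
  show ?thesis by (simp add: trivial_orbits_def)
qed

lemma GDD45_with5_11: "GDD45_with5 11"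
proof -
  have "difference_family [4, 5] 22 2 11 2 (
    [[(0, 0), (1, 0), (4, 0), (2, 1)], [(0, 0), (2, 0), (17, 1), (9, 0), (14, 0)], [(0, 0), (6, 0),
    (10, 1), (13, 1)], [(0, 0), (5, 1), (6, 1), (19, 1)], [(0, 0), (9, 1), (14, 1), (21, 1)], [(0, 0),
    (12, 1), (16, 1), (18, 1)]])"
    by code_simp
  from GDD45_cyclic(2)[OF this, where k = 1 and s = 2]
  show ?thesis by (simp)
qed

lemma GDD45_with5_12: "GDD45_with5 12"
proof -
  have "difference_family [4, 5] 48 1 12 1 (
    [[(0, 0), (1, 0), (43, 0), (33, 0)], [(0, 0), (2, 0), (22, 0), (9, 0)], [(0, 0), (3, 0), (30, 0),
    (34, 0), (11, 0)]])"
    by code_simp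
  from GDD45_cyclic(2)[OF this, where k = 1 and s = 4]
  show ?thesis by (simp)
qed

lemma GDD45_with5_13: "GDD45_with5 13"
proof -
  have "difference_family [4, 5] 26 2 13 2 (
    [[(0, 0), (1, 0), (19, 1), (12, 1), (18, 0)], [(0, 0), (2, 0), (17, 1), (7, 1)], [(0, 0), (3, 0),
    (14, 0), (9, 1), (10, 0)], [(0, 0), (5, 0), (3, 1), (2, 1)], [(0, 0), (6, 0), (22, 1), (14, 1),
    (10, 1)], [(0, 1), (2, 1), (5, 1), (11, 1)]])"
    by code_simp
  from GDD45_cyclic(2)[OF this, where k = 1 and s = 2]
  show ?thesis by (simp)
qed

lemma GDD45_with5_14: "GDD45_with5 14"
proof -
  have "difference_family [4, 5] 56 1 14 1 (
    [[(0, 0), (1, 0), (51, 0), (16, 0), (13, 0)], [(0, 0), (2, 0), (22, 0), (26, 0), (33, 0)], [(0, 0),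
    (8, 0), (37, 0), (47, 0)]])"
    by code_simp
  from GDD45_cyclic(2)[OF this, where k = 1 and s = 4]
  show ?thesis by (simp)
qed

lemma GDD45_with5_15: "GDD45_with5 15"
proof -
  have "difference_family [4, 5] 60 1 15 1 (
    [[(0, 0), (1, 0), (25, 0), (8, 0), (29, 0)], [(0, 0), (2, 0), (5, 0), (49, 0)], [(0, 0), (6, 0),
    (48, 0), (26, 0)], [(0, 0), (9, 0), (46, 0), (19, 0)]])"
    by code_simp
  from GDD45_cyclic(2)[OF this, where k = 1 and s = 4]
  show ?thesis by (simp)
qed

lemma GDD45_with5_16: "GDD45_with5 16"
proof -
  have "difference_family [4, 5] 64 1 16 1 (
    [[(0, 0), (1, 0), (61, 0), (23, 0), (11, 0)], [(0, 0), (2, 0), (20, 0), (59, 0), (35, 0)], [(0, 0),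
    (6, 0), (19, 0), (27, 0), (36, 0)]])"
    by code_simp
  from GDD45_cyclic(2)[OF this, where k = 1 and s = 4]
  show ?thesis by (simp)
qed

lemma GDD45_with5_17: "GDD45_with5 17"
proof -
  have "difference_family [4, 5] 68 1 17 1 (
    [[(0, 0), (1, 0), (5, 0), (47, 0), (62, 0)], [(0, 0), (2, 0), (45, 0), (31, 0)], [(0, 0), (3, 0),
    (36, 0), (27, 0), (55, 0)], [(0, 0), (8, 0), (56, 0), (18, 0)]])"
    by code_simp
  from GDD45_cyclic(2)[OF this, where k = 1 and s = 4]
  show ?thesis by (simp)
qed

lemma GDD45_with5_18: "GDD45_with5 18"
proof -
  have "difference_family [4, 5] 72 1 18 1 (
    [[(0, 0), (1, 0), (6, 0), (44, 0)], [(0, 0), (2, 0), (59, 0), (47, 0)], [(0, 0), (3, 0), (24, 0),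
    (10, 0)], [(0, 0), (4, 0), (39, 0), (50, 0), (20, 0)], [(0, 0), (8, 0), (31, 0), (63, 0)]])"
    by code_simp
  from GDD45_cyclic(2)[OF this, where k = 1 and s = 4]
  show ?thesis by (simp)
qed

lemma GDD45_with5_19: "GDD45_with5 19"
proof -
  have "difference_family [4, 5] 76 1 19 1 (
    [[(0, 0), (1, 0), (36, 0), (49, 0), (24, 0)], [(0, 0), (2, 0), (56, 0), (70, 0), (61, 0)], [(0, 0),
    (3, 0), (72, 0), (33, 0)], [(0, 0), (10, 0), (42, 0), (31, 0), (60, 0)]])"
    by code_simp
  from GDD45_cyclic(2)[OF this, where k = 1 and s = 4]
  show ?thesis by (simp)
qed

lemma GDD45_with5_20: "GDD45_with5 20"
proof -
  have "difference_family [4, 5] 80 1 20 1 (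
    [[(0, 0), (1, 0), (26, 0), (34, 0)], [(0, 0), (2, 0), (5, 0), (73, 0)], [(0, 0), (4, 0), (62, 0),
    (45, 0), (14, 0)], [(0, 0), (6, 0), (29, 0), (67, 0), (56, 0)], [(0, 0), (15, 0), (59, 0), (43, 0)]])"
    by code_simp
  from GDD45_cyclic(2)[OF this, where k = 1 and s = 4]
  show ?thesis by (simp)
qed

lemma GDD45_with5_21: "GDD45_with5 21"
proof -
  have "difference_family [4, 5] 84 1 21 1 (
    [[(0, 0), (1, 0), (15, 0), (82, 0)], [(0, 0), (4, 0), (37, 0), (66, 0)], [(0, 0), (5, 0), (45, 0),
    (35, 0)], [(0, 0), (6, 0), (58, 0), (77, 0), (31, 0)], [(0, 0), (8, 0), (36, 0), (24, 0)], [(0, 0),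
    (9, 0), (50, 0), (73, 0)]])"
    by code_simp
  from GDD45_cyclic(2)[OF this, where k = 1 and s = 4]
  show ?thesis by (simp)
qed

lemma GDD45_with5_22: "GDD45_with5 22"
proof -
  have "difference_family [4, 5] 88 1 22 1 (
    [[(0, 0), (1, 0), (78, 0), (18, 0), (82, 0)], [(0, 0), (2, 0), (69, 0), (40, 0)], [(0, 0), (3, 0),
    (75, 0), (33, 0)], [(0, 0), (5, 0), (52, 0), (37, 0), (25, 0)], [(0, 0), (8, 0), (43, 0), (34, 0),
    (57, 0)]])"
    by code_simp
  from GDD45_cyclic(2)[OF this, where k = 1 and s = 4]
  show ?thesis by (simp)
qed

lemma GDD45_with5_23: "GDD45_with5 23"
proof -
  have "difference_family [4, 5] 92 1 23 1 (
    [[(0, 0), (1, 0), (39, 0), (29, 0)], [(0, 0), (2, 0), (74, 0), (6, 0)], [(0, 0), (3, 0), (47, 0),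
    (36, 0)], [(0, 0), (5, 0), (19, 0), (60, 0), (85, 0)], [(0, 0), (8, 0), (43, 0), (83, 0), (21, 0)],
    [(0, 0), (15, 0), (76, 0), (42, 0)]])"
    by code_simp
  from GDD45_cyclic(2)[OF this, where k = 1 and s = 4]
  show ?thesis by (simp)
qed

lemma GDD45_with5_24: "GDD45_with5 24"
proof -
  have "difference_family [4, 5] 96 1 24 1 (
    [[(0, 0), (1, 0), (41, 0), (85, 0)], [(0, 0), (2, 0), (33, 0), (82, 0)], [(0, 0), (3, 0), (39, 0),
    (18, 0)], [(0, 0), (4, 0), (32, 0), (10, 0), (77, 0)], [(0, 0), (5, 0), (30, 0), (43, 0)], [(0, 0),
    (7, 0), (69, 0), (61, 0)], [(0, 0), (9, 0), (26, 0), (46, 0)]])"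
    by code_simp
  from GDD45_cyclic(2)[OF this, where k = 1 and s = 4]
  show ?thesis by (simp)
qed

lemma GDD45_with5_25: "GDD45_with5 25"
proof -
  have "difference_family [4, 5] 100 1 25 1 (
    [[(0, 0), (1, 0), (92, 0), (30, 0)], [(0, 0), (2, 0), (12, 0), (35, 0)], [(0, 0), (3, 0), (46, 0),
    (22, 0), (63, 0)], [(0, 0), (4, 0), (20, 0), (51, 0), (15, 0)], [(0, 0), (6, 0), (93, 0), (45, 0),
    (72, 0)], [(0, 0), (14, 0), (56, 0), (82, 0)]])"
    by code_simp
  from GDD45_cyclic(2)[OF this, where k = 1 and s = 4]
  show ?thesis by (simp)
qed

lemma GDD45_with5_26: "GDD45_with5 26"
proof -
  have "difference_family [4, 5] 104 1 26 1 (
    [[(0, 0), (1, 0), (90, 0), (72, 0)], [(0, 0), (2, 0), (10, 0), (30, 0), (7, 0)], [(0, 0), (4, 0),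
    (21, 0), (59, 0)], [(0, 0), (6, 0), (50, 0), (91, 0), (62, 0)], [(0, 0), (9, 0), (34, 0), (73, 0)],
    [(0, 0), (11, 0), (47, 0), (69, 0)], [(0, 0), (16, 0), (53, 0), (77, 0)]])"
    by code_simp
  from GDD45_cyclic(2)[OF this, where k = 1 and s = 4]
  show ?thesis by (simp)
qed

lemma GDD45_with5_27: "GDD45_with5 27"
proof -
  have "difference_family [4, 5] 108 1 27 1 (
    [[(0, 0), (1, 0), (73, 0), (18, 0)], [(0, 0), (2, 0), (45, 0), (40, 0)], [(0, 0), (3, 0), (50, 0),
    (89, 0)], [(0, 0), (4, 0), (80, 0), (16, 0)], [(0, 0), (6, 0), (77, 0), (100, 0), (48, 0)], [(0, 0),
    (7, 0), (95, 0), (33, 0)], [(0, 0), (9, 0), (24, 0), (83, 0)], [(0, 0), (10, 0), (21, 0), (51, 0)]])"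
    by code_simp
  from GDD45_cyclic(2)[OF this, where k = 1 and s = 4]
  show ?thesis by (simp)
qed

section \<open>Explicit triples of decompositions of the pieces\<close>

lemma three_way_multipartite_4_3_9: "three_way (multipartite {..<4::nat} 3) 9"
proof -
  define b1 :: "int list list" where "b1 =
    [[0, 3, 6, 9], [0, 4, 7, 11], [0, 5, 8, 10], [1, 3, 7, 10], [1, 4, 8, 9], [1, 5, 6, 11],
    [2, 3, 8, 11], [2, 4, 6, 10], [2, 5, 7, 9]]"
  \<comment> \<open>Obtained from \<open>b1\<close> by the cyclic relabelling 9, 10, 11 of the last
    group; \<open>b3\<close> applies it twice. The first three points of a block stay and the fourth
    moves, so no block is shared.\<close>
  define b2 :: "int list list" where "b2 =
    [[0, 3, 6, 10], [0, 4, 7, 9], [0, 5, 8, 11], [1, 3, 7, 11], [1, 4, 8, 10], [1, 5, 6, 9],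
    [2, 3, 8, 9], [2, 4, 6, 11], [2, 5, 7, 10]]"
  define b3 :: "int list list" where "b3 =
    [[0, 3, 6, 11], [0, 4, 7, 10], [0, 5, 8, 9], [1, 3, 7, 9], [1, 4, 8, 11], [1, 5, 6, 10],
    [2, 3, 8, 10], [2, 4, 6, 9], [2, 5, 7, 11]]"
  have df1: "difference_family [4] 1 12 1 3 (trivial_orbits b1)" unfolding b1_def by code_simp
  have df2: "difference_family [4] 1 12 1 3 (trivial_orbits b2)" unfolding b2_def by code_simp
  have df3: "difference_family [4] 1 12 1 3 (trivial_orbits b3)" unfolding b3_def by code_simp
  have "set ` set b1 \<inter> set ` set b2 = set ` set b1 \<inter> set ` set b3"
    "set ` set b1 \<inter> set ` set b3 = set ` set b2 \<inter> set ` set b3"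
    "card (set ` set b1 - set ` set b2) = 9"
    unfolding b1_def b2_def b3_def by code_simp+
  from three_way_lists[OF df1 df2 df3 _ _ _ this, of 4] show ?thesis by simp
qed

text \<open>The projective plane of order 3 as the translates of the perfect difference set {0, 1,
  3, 9} modulo 13.\<close>

definition plane_3 :: "int list list" where "plane_3 =
    [[0, 1, 3, 9], [0, 2, 8, 12], [0, 4, 5, 7], [0, 6, 10, 11], [1, 2, 4, 10], [1, 5, 6, 8],
    [1, 7, 11, 12], [2, 3, 5, 11], [2, 6, 7, 9], [3, 4, 6, 12], [3, 7, 8, 10], [4, 8, 9, 11],
    [5, 9, 10, 12]]"

lemma plane_3_family: "difference_family [4] 1 13 1 1 (trivial_orbits plane_3)"
  by code_simp

lemma three_way_multipartite_13_1_13: "three_way (multipartite {..<13::nat} 1) 13"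
proof -
  define b2 :: "int list list" where "b2 =
    [[0, 1, 4, 9], [0, 2, 3, 10], [0, 5, 7, 12], [0, 6, 8, 11], [1, 2, 6, 12], [1, 3, 5, 8],
    [1, 7, 10, 11], [2, 4, 7, 8], [2, 5, 9, 11], [3, 4, 11, 12], [3, 6, 7, 9], [4, 5, 6, 10],
    [8, 9, 10, 12]]"
  define b3 :: "int list list" where "b3 =
    [[0, 1, 6, 12], [0, 2, 9, 10], [0, 3, 4, 5], [0, 7, 8, 11], [1, 2, 5, 7], [1, 3, 8, 10],
    [1, 4, 9, 11], [2, 3, 6, 11], [2, 4, 8, 12], [3, 7, 9, 12], [4, 6, 7, 10], [5, 6, 8, 9],
    [5, 10, 11, 12]]"
  have df2: "difference_family [4] 1 13 1 1 (trivial_orbits b2)" unfolding b2_def by code_simp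
  have df3: "difference_family [4] 1 13 1 1 (trivial_orbits b3)" unfolding b3_def by code_simp
  have "set ` set plane_3 \<inter> set ` set b2 = set ` set plane_3 \<inter> set ` set b3"
    "set ` set plane_3 \<inter> set ` set b3 = set ` set b2 \<inter> set ` set b3"
    "card (set ` set plane_3 - set ` set b2) = 13"
    unfolding b2_def b3_def by code_simp+
  from three_way_lists[OF plane_3_family df2 df3 _ _ _ this, of 13] show ?thesis by simp
qed

lemma three_way_multipartite_13_1_12: "three_way (multipartite {..<13::nat} 1) 12"
proof -
  define b2 :: "int list list" where "b2 =
    [[0, 1, 7, 9], [0, 2, 6, 11], [0, 3, 4, 12], [0, 5, 8, 10], [1, 2, 8, 12], [1, 3, 10, 11],
    [1, 4, 5, 6], [2, 3, 5, 9], [2, 4, 7, 10], [3, 6, 7, 8], [4, 8, 9, 11], [5, 7, 11, 12],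
    [6, 9, 10, 12]]"
  define b3 :: "int list list" where "b3 =
    [[0, 1, 6, 8], [0, 2, 3, 4], [0, 5, 10, 11], [0, 7, 9, 12], [1, 2, 11, 12], [1, 3, 5, 9],
    [1, 4, 7, 10], [2, 5, 7, 8], [2, 6, 9, 10], [3, 6, 7, 11], [3, 8, 10, 12], [4, 5, 6, 12],
    [4, 8, 9, 11]]"
  have df2: "difference_family [4] 1 13 1 1 (trivial_orbits b2)" unfolding b2_def by code_simp
  have df3: "difference_family [4] 1 13 1 1 (trivial_orbits b3)" unfolding b3_def by code_simp
  have "set ` set plane_3 \<inter> set ` set b2 = set ` set plane_3 \<inter> set ` set b3"
    "set ` set plane_3 \<inter> set ` set b3 = set ` set b2 \<inter> set ` set b3"
    "card (set ` set plane_3 - set ` set b2) = 12"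
    unfolding b2_def b3_def by code_simp+
  from three_way_lists[OF plane_3_family df2 df3 _ _ _ this, of 13] show ?thesis by simp
qed

lemma three_way_multipartite_13_1_11: "three_way (multipartite {..<13::nat} 1) 11"
proof -
  define b2 :: "int list list" where "b2 =
    [[0, 1, 3, 11], [0, 2, 8, 12], [0, 4, 5, 7], [0, 6, 9, 10], [1, 2, 4, 6], [1, 5, 8, 9],
    [1, 7, 10, 12], [2, 3, 7, 9], [2, 5, 10, 11], [3, 4, 8, 10], [3, 5, 6, 12], [4, 9, 11, 12],
    [6, 7, 8, 11]]"
  define b3 :: "int list list" where "b3 =
    [[0, 1, 6, 9], [0, 2, 8, 12], [0, 3, 10, 11], [0, 4, 5, 7], [1, 2, 5, 10], [1, 3, 4, 12],
    [1, 7, 8, 11], [2, 3, 6, 7], [2, 4, 9, 11], [3, 5, 8, 9], [4, 6, 8, 10], [5, 6, 11, 12],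
    [7, 9, 10, 12]]"
  have df2: "difference_family [4] 1 13 1 1 (trivial_orbits b2)" unfolding b2_def by code_simp
  have df3: "difference_family [4] 1 13 1 1 (trivial_orbits b3)" unfolding b3_def by code_simp
  have "set ` set plane_3 \<inter> set ` set b2 = set ` set plane_3 \<inter> set ` set b3"
    "set ` set plane_3 \<inter> set ` set b3 = set ` set b2 \<inter> set ` set b3"
    "card (set ` set plane_3 - set ` set b2) = 11"
    unfolding b2_def b3_def by code_simp+
  from three_way_lists[OF plane_3_family df2 df3 _ _ _ this, of 13] show ?thesis by simp
qed

lemma three_way_multipartite_13_1_10: "three_way (multipartite {..<13::nat} 1) 10"
proof -
  define b2 :: "int list list" where "b2 =
    [[0, 1, 3, 9], [0, 2, 4, 8], [0, 5, 10, 11], [0, 6, 7, 12], [1, 2, 7, 11], [1, 4, 10, 12],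
    [1, 5, 6, 8], [2, 3, 5, 12], [2, 6, 9, 10], [3, 4, 6, 11], [3, 7, 8, 10], [4, 5, 7, 9],
    [8, 9, 11, 12]]"
  define b3 :: "int list list" where "b3 =
    [[0, 1, 3, 9], [0, 2, 8, 11], [0, 4, 6, 10], [0, 5, 7, 12], [1, 2, 4, 7], [1, 5, 6, 8],
    [1, 10, 11, 12], [2, 3, 6, 12], [2, 5, 9, 10], [3, 4, 5, 11], [3, 7, 8, 10], [4, 8, 9, 12],
    [6, 7, 9, 11]]"
  have df2: "difference_family [4] 1 13 1 1 (trivial_orbits b2)" unfolding b2_def by code_simp
  have df3: "difference_family [4] 1 13 1 1 (trivial_orbits b3)" unfolding b3_def by code_simp
  have "set ` set plane_3 \<inter> set ` set b2 = set ` set plane_3 \<inter> set ` set b3"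
    "set ` set plane_3 \<inter> set ` set b3 = set ` set b2 \<inter> set ` set b3"
    "card (set ` set plane_3 - set ` set b2) = 10"
    unfolding b2_def b3_def by code_simp+
  from three_way_lists[OF plane_3_family df2 df3 _ _ _ this, of 13] show ?thesis by simp
qed

text \<open>The common blocks are the four lines through the point 1. What remains is a copy of
  \<open>K\<close>(3,3,3,3) on the other twelve points, decomposed in three disjoint ways.\<close>

lemma three_way_multipartite_13_1_9: "three_way (multipartite {..<13::nat} 1) 9"
proof -
  define b2 :: "int list list" where "b2 =
    [[0, 1, 3, 9], [0, 2, 5, 7], [0, 4, 6, 11], [0, 8, 10, 12], [1, 2, 4, 10], [1, 5, 6, 8],
    [1, 7, 11, 12], [2, 3, 6, 12], [2, 8, 9, 11], [3, 4, 7, 8], [3, 5, 10, 11], [4, 5, 9, 12],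
    [6, 7, 9, 10]]"
  define b3 :: "int list list" where "b3 =
    [[0, 1, 3, 9], [0, 2, 5, 11], [0, 4, 8, 12], [0, 6, 7, 10], [1, 2, 4, 10], [1, 5, 6, 8],
    [1, 7, 11, 12], [2, 3, 7, 8], [2, 6, 9, 12], [3, 4, 6, 11], [3, 5, 10, 12], [4, 5, 7, 9],
    [8, 9, 10, 11]]"
  have df2: "difference_family [4] 1 13 1 1 (trivial_orbits b2)" unfolding b2_def by code_simp
  have df3: "difference_family [4] 1 13 1 1 (trivial_orbits b3)" unfolding b3_def by code_simp
  have "set ` set plane_3 \<inter> set ` set b2 = set ` set plane_3 \<inter> set ` set b3"
    "set ` set plane_3 \<inter> set ` set b3 = set ` set b2 \<inter> set ` set b3"
    "card (set ` set plane_3 - set ` set b2) = 9"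
    unfolding b2_def b3_def by code_simp+
  from three_way_lists[OF plane_3_family df2 df3 _ _ _ this, of 13] show ?thesis by simp
qed

text \<open>The common blocks are the four lines through the point 5 and one further line, {0, 2, 8,
  12}. This attains the lower bound 8, and the points of that further line have degree 2 in the
  remainder.\<close>

lemma three_way_multipartite_13_1_8: "three_way (multipartite {..<13::nat} 1) 8"
proof -
  define b2 :: "int list list" where "b2 =
    [[0, 1, 3, 10], [0, 2, 8, 12], [0, 4, 5, 7], [0, 6, 9, 11], [1, 2, 7, 9], [1, 4, 11, 12],
    [1, 5, 6, 8], [2, 3, 5, 11], [2, 4, 6, 10], [3, 4, 8, 9], [3, 6, 7, 12], [5, 9, 10, 12],
    [7, 8, 10, 11]]"
  define b3 :: "int list list" where "b3 =
    [[0, 1, 9, 11], [0, 2, 8, 12], [0, 3, 6, 10], [0, 4, 5, 7], [1, 2, 7, 10], [1, 3, 4, 12],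
    [1, 5, 6, 8], [2, 3, 5, 11], [2, 4, 6, 9], [3, 7, 8, 9], [4, 8, 10, 11], [5, 9, 10, 12],
    [6, 7, 11, 12]]"
  have df2: "difference_family [4] 1 13 1 1 (trivial_orbits b2)" unfolding b2_def by code_simp
  have df3: "difference_family [4] 1 13 1 1 (trivial_orbits b3)" unfolding b3_def by code_simp
  have "set ` set plane_3 \<inter> set ` set b2 = set ` set plane_3 \<inter> set ` set b3"
    "set ` set plane_3 \<inter> set ` set b3 = set ` set b2 \<inter> set ` set b3"
    "card (set ` set plane_3 - set ` set b2) = 8"
    unfolding b2_def b3_def by code_simp+
  from three_way_lists[OF plane_3_family df2 df3 _ _ _ this, of 13] show ?thesis by simp
qed

text \<open>The affine plane of order 4 without one point; the lines through that point become the groups.\<close>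

definition punctured_plane_4 :: "int list list" where "punctured_plane_4 =
    [[0, 3, 6, 9], [0, 4, 8, 14], [0, 5, 10, 13], [0, 7, 11, 12], [1, 3, 11, 14], [1, 4, 7, 10],
    [1, 5, 6, 12], [1, 8, 9, 13], [2, 3, 7, 13], [2, 4, 9, 12], [2, 5, 8, 11], [2, 6, 10, 14],
    [3, 8, 10, 12], [4, 6, 11, 13], [5, 7, 9, 14]]"

lemma punctured_plane_4_family: "difference_family [4] 1 15 1 3 (trivial_orbits punctured_plane_4)"
  by code_simp

lemma three_way_multipartite_5_3_15: "three_way (multipartite {..<5::nat} 3) 15"
proof -
  define b2 :: "int list list" where "b2 =
    [[0, 3, 6, 14], [0, 4, 11, 12], [0, 5, 7, 10], [0, 8, 9, 13], [1, 3, 10, 13], [1, 4, 6, 9],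
    [1, 5, 8, 12], [1, 7, 11, 14], [2, 3, 8, 11], [2, 4, 7, 13], [2, 5, 9, 14], [2, 6, 10, 12],
    [3, 7, 9, 12], [4, 8, 10, 14], [5, 6, 11, 13]]"
  define b3 :: "int list list" where "b3 =
    [[0, 3, 8, 9], [0, 4, 7, 14], [0, 5, 11, 13], [0, 6, 10, 12], [1, 3, 6, 13], [1, 4, 9, 12],
    [1, 5, 7, 10], [1, 8, 11, 14], [2, 3, 10, 14], [2, 4, 6, 11], [2, 5, 8, 12], [2, 7, 9, 13],
    [3, 7, 11, 12], [4, 8, 10, 13], [5, 6, 9, 14]]"
  have df2: "difference_family [4] 1 15 1 3 (trivial_orbits b2)" unfolding b2_def by code_simp
  have df3: "difference_family [4] 1 15 1 3 (trivial_orbits b3)" unfolding b3_def by code_simp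
  have "set ` set punctured_plane_4 \<inter> set ` set b2 = set ` set punctured_plane_4 \<inter> set ` set b3"
    "set ` set punctured_plane_4 \<inter> set ` set b3 = set ` set b2 \<inter> set ` set b3"
    "card (set ` set punctured_plane_4 - set ` set b2) = 15"
    unfolding b2_def b3_def by code_simp+
  from three_way_lists[OF punctured_plane_4_family df2 df3 _ _ _ this, of 5] show ?thesis by simp
qed

lemma three_way_multipartite_5_3_14: "three_way (multipartite {..<5::nat} 3) 14"
proof -
  define b2 :: "int list list" where "b2 =
    [[0, 3, 7, 10], [0, 4, 11, 12], [0, 5, 6, 13], [0, 8, 9, 14], [1, 3, 8, 12], [1, 4, 6, 9],
    [1, 5, 10, 14], [1, 7, 11, 13], [2, 3, 9, 13], [2, 4, 7, 14], [2, 5, 8, 11], [2, 6, 10, 12],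
    [3, 6, 11, 14], [4, 8, 10, 13], [5, 7, 9, 12]]"
  define b3 :: "int list list" where "b3 =
    [[0, 3, 11, 13], [0, 4, 6, 9], [0, 5, 7, 12], [0, 8, 10, 14], [1, 3, 7, 10], [1, 4, 8, 13],
    [1, 5, 9, 14], [1, 6, 11, 12], [2, 3, 6, 14], [2, 4, 10, 12], [2, 5, 8, 11], [2, 7, 9, 13],
    [3, 8, 9, 12], [4, 7, 11, 14], [5, 6, 10, 13]]"
  have df2: "difference_family [4] 1 15 1 3 (trivial_orbits b2)" unfolding b2_def by code_simp
  have df3: "difference_family [4] 1 15 1 3 (trivial_orbits b3)" unfolding b3_def by code_simp
  have "set ` set punctured_plane_4 \<inter> set ` set b2 = set ` set punctured_plane_4 \<inter> set ` set b3"
    "set ` set punctured_plane_4 \<inter> set ` set b3 = set ` set b2 \<inter> set ` set b3"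
    "card (set ` set punctured_plane_4 - set ` set b2) = 14"
    unfolding b2_def b3_def by code_simp+
  from three_way_lists[OF punctured_plane_4_family df2 df3 _ _ _ this, of 5] show ?thesis by simp
qed

section \<open>The spectrum\<close>

lemma coprime_30_below:
  fixes w :: nat
  assumes "w \<ge> 14"
  shows "\<exists>m\<in>{w - 5..w}. coprime m 30"
proof -
  define y where "y = (w - 5) mod 30"
  have "y < 30" by (simp add: y_def)
  then have "y \<le> 1 \<or> 2 \<le> y \<and> y \<le> 7 \<or> 8 \<le> y \<and> y \<le> 11 \<or> 12 \<le> y \<and> y \<le> 13 \<or> 14 \<le> y \<and> y \<le> 17 \<or>
      18 \<le> y \<and> y \<le> 19 \<or> 20 \<le> y \<and> y \<le> 23 \<or> 24 \<le> y \<and> y \<le> 29"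
    by linarith
  \<comment> \<open>Consecutive residues coprime to 30 are at most 6 apart, so six consecutive
    integers always contain one.\<close>
  then have "\<exists>c\<in>{1, 7, 11, 13, 17, 19, 23, 29}. y \<le> c \<and> c \<le> y + 5"
    by (elim disjE) simp_all
  then obtain c where c: "c \<in> {1, 7, 11, 13, 17, 19, 23, 29}" "y \<le> c" "c \<le> y + 5" by blast
  have "coprime (c mod 30) 30" using c(1)
    by (elim insertE emptyE) (simp_all add: coprime_iff_gcd_eq_1 gcd_non_0_nat)
  moreover have "c mod 30 = (w - 5 + (c - y)) mod 30"
    using c(2) mod_add_left_eq[of "w - 5" 30 "c - y"] unfolding y_def by simp
  ultimately have "coprime (w - 5 + (c - y)) 30" by simp
  then show ?thesis using c(3) assms by (intro bexI[of _ "w - 5 + (c - y)"]) auto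
qed

text \<open>Distributes the points beyond the four full groups over the other three without creating
  a group of size 2 or 3. Filling the groups greedily fails only for a remainder of 2 or 3; then
  either single points are split off or a full group gives up one or two points to build a group of
  size 4, and \<open>m >= 7\<close> keeps the reduced group large enough.\<close>

lemma split_three:
  fixes m r :: nat
  assumes "m \<ge> 7" "r \<le> 3 * m"
  shows "\<exists>a b c. a + b + c = r \<and> a \<le> m \<and> b \<le> m \<and> c \<le> m \<and>
    (a \<le> 1 \<or> 4 \<le> a) \<and> (b \<le> 1 \<or> 4 \<le> b) \<and> (c \<le> 1 \<or> 4 \<le> c)"
proof -
  consider "r = 2" | "r = 3" | "r \<le> m" "r \<noteq> 2" "r \<noteq> 3" | "r = m + 2" | "r = m + 3"
    | "m < r" "r \<le> 2 * m" "r \<noteq> m + 2" "r \<noteq> m + 3" | "r = 2 * m + 2" | "r = 2 * m + 3"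
    | "2 * m < r" "r \<noteq> 2 * m + 2" "r \<noteq> 2 * m + 3" by linarith
  then show ?thesis
  proof cases
    case 1 then show ?thesis using assms by (intro exI[of _ 1] exI[of _ 0]) auto
  next
    case 2 then show ?thesis using assms by (intro exI[of _ 1]) auto
  next
    case 3 then show ?thesis using assms by (intro exI[of _ r] exI[of _ 0]) auto
  next
    case 4 then show ?thesis using assms by (intro exI[of _ m] exI[of _ 1]) auto
  next
    case 5 then show ?thesis using assms by (intro exI[of _ "m - 1"] exI[of _ 4] exI[of _ 0]) auto
  next
    case 6 then show ?thesis using assms by (intro exI[of _ m] exI[of _ "r - m"] exI[of _ 0]) auto
  next
    case 7 then show ?thesis using assms by (intro exI[of _ m] exI[of _ "m - 2"] exI[of _ 4]) auto
  next
    case 8 then show ?thesis using assms by (intro exI[of _ m] exI[of _ "m - 1"] exI[of _ 4]) auto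
  next
    case 9 then show ?thesis using assms by (intro exI[of _ m] exI[of _ "r - 2 * m"]) auto
  qed
qed

lemma GDD45_with5_exists: "u \<ge> 5 \<Longrightarrow> GDD45_with5 u"
proof (induction u rule: less_induct)
  case (less u)
  show ?case
  proof (cases "u < 28")
    case True
    with less.prems have "u \<in> {5, 6, 7, 8, 9, 10, 11, 12, 13, 14, 15, 16, 17, 18, 19, 20, 21, 22, 23, 24,
      25, 26, 27}" unfolding insert_iff empty_iff by presburger
    then show ?thesis
      using GDD45_with5_5 GDD45_with5_6 GDD45_with5_7 GDD45_with5_8 GDD45_with5_9 GDD45_with5_10
        GDD45_with5_11 GDD45_with5_12 GDD45_with5_13 GDD45_with5_14 GDD45_with5_15 GDD45_with5_16
        GDD45_with5_17 GDD45_with5_18 GDD45_with5_19 GDD45_with5_20 GDD45_with5_21 GDD45_with5_22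
        GDD45_with5_23 GDD45_with5_24 GDD45_with5_25 GDD45_with5_26 GDD45_with5_27
      by blast
  next
    case False
    \<comment> \<open>The windows from \<open>4 m\<close> to \<open>7 m\<close> have to cover
      everything from 28 on: \<open>m = 7\<close> covers 28 to 49, \<open>m = 11\<close> covers 50
      to 55, and larger \<open>u\<close> take \<open>m\<close> just below
      \<open>u div 4\<close>.\<close>
    have "\<exists>m\<ge>7. coprime m 30 \<and> 4 * m \<le> u \<and> u \<le> 7 * m"
    proof (cases "u < 56")
      case True
      show ?thesis
      proof (cases "u \<le> 49")
        case True
        then show ?thesis using False by (intro exI[of _ 7]) (auto simp: coprime_iff_gcd_eq_1 gcd_non_0_nat)
      next
        case False
        then show ?thesis using \<open>u < 56\<close> by (intro exI[of _ 11]) (auto simp: coprime_iff_gcd_eq_1 gcd_non_0_nat)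
      qed
    next
      case False
      then have "14 \<le> u div 4" by simp
      then obtain m where m: "m \<in> {u div 4 - 5..u div 4}" "coprime m 30"
        using coprime_30_below by blast
      \<comment> \<open>For \<open>w = u div 4\<close> one has \<open>u <= 4 w + 3\<close> and
        \<open>7 m >= 7 w - 35\<close>; the second bound dominates as soon as
        \<open>3 w >= 38\<close>.\<close>
      with False have "7 \<le> m" "4 * m \<le> u" "u \<le> 7 * m" by auto
      with m show ?thesis by blast
    qed
    then obtain m where m: "m \<ge> 7" "coprime m 30" "4 * m \<le> u" "u \<le> 7 * m" by blast
    then have "u - 4 * m \<le> 3 * m" by simp
    then obtain a b c where abc: "a + b + c = u - 4 * m" "a \<le> m" "b \<le> m" "c \<le> m"
        "a \<le> 1 \<or> 4 \<le> a" "b \<le> 1 \<or> 4 \<le> b" "c \<le> 1 \<or> 4 \<le> c"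
      using split_three[OF m(1)] by blast
    define s where "s = (\<lambda>j::nat. if j < 4 then m else if j = 4 then a else if j = 5 then b else c)"
    have gdd: "GDD45 k" if "4 \<le> k" "k < u" for k
      using that less.IH[of k] GDD45_4 GDD45_with5_imp[of k] by (cases "k = 4") auto
    have "GDD45_with5 (\<Sum>j<7. s j)"
    proof (rule GDD45_truncated[OF m(1,2)])
      fix j :: nat assume "s j \<ge> 2"
      then have "4 \<le> s j" "s j \<le> m" using abc m(1) unfolding s_def by (auto split: if_splits)
      then show "GDD45 (s j)" using gdd[of "s j"] m by simp
    qed (use abc m gdd less.IH[of m] in \<open>auto simp: s_def\<close>)
    moreover have "(\<Sum>j<7. s j) = 4 * m + a + b + c"
      by (simp add: s_def eval_nat_numeral lessThan_Suc)
    moreover have "4 * m + a + b + c = u" using abc(1) m(3) by simp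
    ultimately show ?thesis by simp
  qed
qed

section \<open>Adding up volumes over the pieces\<close>

lemma three_way_zero: "three_way P d \<Longrightarrow> three_way P 0"
  using three_way_0 unfolding three_way_def[of P d] by blast

lemma three_way_multipartite:
  assumes "three_way (multipartite {..<k::nat} w) d" "finite b" "card b = k"
  shows "three_way (multipartite b w) d"
proof -
  obtain f where f: "bij_betw f {..<k} b"
    using finite_same_card_bij[of "{..<k}" b] assms by auto
  show ?thesis
    using three_way_image[OF assms(1) multipartite_subset multipartite_bij(1)[OF f]]
    unfolding multipartite_bij(2)[OF f] .
qed

lemma arcs_image: "inj_on f A \<Longrightarrow> map_prod f f ` arcs A = arcs (f ` A)"
  unfolding arcs_def by (auto simp: inj_on_def image_iff)

lemma three_way_arcs_13:
  assumes "finite A" "card A = 13" "d = 0 \<or> 8 \<le> d \<and> d \<le> 13"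
  shows "three_way (arcs A) d"
proof -
  have "three_way (multipartite {..<13::nat} 1) d"
  proof (cases "d = 0")
    case True
    then show ?thesis using three_way_zero[OF three_way_multipartite_13_1_13] by simp
  next
    case False
    then have "d \<in> {8, 9, 10, 11, 12, 13}" using assms(3) by auto
    then show ?thesis
      using three_way_multipartite_13_1_13 three_way_multipartite_13_1_12 three_way_multipartite_13_1_11
        three_way_multipartite_13_1_10 three_way_multipartite_13_1_9 three_way_multipartite_13_1_8 by blast
  qed
  then have "three_way (multipartite A 1) d" by (rule three_way_multipartite[OF _ assms(1,2)])
  moreover have "inj_on fst (A \<times> {..<1::nat})" by (auto simp: inj_on_def)
  moreover have "map_prod fst fst ` multipartite A 1 = arcs A"
    by (force simp: multipartite_def arcs_def image_iff)
  ultimately show ?thesis using three_way_image[OF _ multipartite_subset] by metis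
qed

lemma three_way_UN_13:
  assumes "finite I" and "\<And>i. i \<in> I \<Longrightarrow> finite (Q i)"
    and "\<And>i j. i \<in> I \<Longrightarrow> j \<in> I \<Longrightarrow> i \<noteq> j \<Longrightarrow> Q i \<inter> Q j = {}"
    and "\<And>i e. i \<in> I \<Longrightarrow> e = 0 \<or> 8 \<le> e \<and> e \<le> 13 \<Longrightarrow> three_way (Q i) e"
    and "d \<le> 13 * card I" "d = 0 \<or> 8 \<le> d \<and> d \<le> 13 \<or> 16 \<le> d"
  shows "three_way (\<Union>i\<in>I. Q i) d"
  using assms
proof (induction I arbitrary: d rule: finite_induct)
  case empty
  have "decomposes {4} {} {}" unfolding decomposes_def by simp
  then show ?case using empty three_way_0 by auto
next
  case (insert i I)
  have IH: "three_way (\<Union>i\<in>I. Q i) d"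
    if "d \<le> 13 * card I" "d = 0 \<or> 8 \<le> d \<and> d \<le> 13 \<or> 16 \<le> d" for d
    using insert.IH[OF _ _ _ that] insert.prems(1-3) by blast
  have "\<exists>e. (e = 0 \<or> 8 \<le> e \<and> e \<le> 13) \<and> e \<le> d \<and> d - e \<le> 13 * card I \<and>
      (d - e = 0 \<or> 8 \<le> d - e \<and> d - e \<le> 13 \<or> 16 \<le> d - e)"
  proof -
    have d: "d \<le> 13 * card I + 13" "d = 0 \<or> 8 \<le> d \<and> d \<le> 13 \<or> 16 \<le> d"
      using insert.prems(4,5) insert.hyps by simp_all
    \<comment> \<open>The remainder must again avoid 1 to 7, 14 and 15. Taking 13 works in general,
      but 16 to 20 would leave 3 to 7, and 27 and 28 would leave 14 and 15; hence 8 and 11 in those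
      ranges.\<close>
    consider "d \<le> 13" | "16 \<le> d" "d \<le> 21" | "22 \<le> d" "d \<le> 26" | "27 \<le> d" "d \<le> 28" | "29 \<le> d"
      using d(2) by linarith
    then show ?thesis
    proof cases
      case 1 then show ?thesis using d by (intro exI[of _ d]) auto
    next
      case 2
      then show ?thesis using d by (intro exI[of _ 8]) (cases "card I", auto)
    next
      case 3
      then show ?thesis using d by (intro exI[of _ 13]) auto
    next
      case 4
      then have "2 \<le> card I" using d by linarith
      then have "d - 11 \<le> 13 * card I" using 4 by linarith
      then show ?thesis using 4 by (intro exI[of _ 11]) auto
    next
      case 5
      then show ?thesis using d by (intro exI[of _ 13]) auto
    qed
  qed
  then obtain e where e: "e = 0 \<or> 8 \<le> e \<and> e \<le> 13" "e \<le> d" "d - e \<le> 13 * card I"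
      "d - e = 0 \<or> 8 \<le> d - e \<and> d - e \<le> 13 \<or> 16 \<le> d - e" by blast
  have "Q i \<inter> (\<Union>i\<in>I. Q i) = {}" using insert.prems(2) insert.hyps(2) by blast
  then have "three_way (Q i \<union> (\<Union>i\<in>I. Q i)) (e + (d - e))"
    using insert.prems(1) insert.hyps(1) insert.prems(3)[OF _ e(1)] IH[OF e(3,4)]
    by (intro three_way_Un) auto
  then show ?case using e(2) by simp
qed

text \<open>A block of size 4 has 12 arcs, so \<open>12 * d <= card P\<close> says that
  \<open>d\<close> does not exceed the number of blocks.\<close>

definition full_spectrum :: "('a \<times> 'a) set \<Rightarrow> bool" where
  "full_spectrum P \<longleftrightarrow> finite P \<and> 22 * 12 \<le> card P \<and> (\<forall>d. (d = 0 \<or> 8 \<le> d) \<and> 12 * d \<le> card P \<longrightarrow> three_way P d)"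

text \<open>The bound \<open>22 \<cdot> 12\<close> ensures that \<open>d - n \<ge> 8\<close> for every \<open>d\<close> that needs the new piece.\<close>

lemma full_spectrum_Un:
  assumes P: "full_spectrum P" and Q: "finite Q" "card Q = 12 * n" "n \<le> 15" "three_way Q 0" "three_way Q n"
    and dis: "P \<inter> Q = {}"
  shows "full_spectrum (P \<union> Q)"
proof -
  have fin: "finite P" and card: "22 * 12 \<le> card P" using P unfolding full_spectrum_def by auto
  have un: "card (P \<union> Q) = card P + 12 * n" using Q fin dis by (simp add: card_Un_disjoint)
  have "three_way (P \<union> Q) d" if d: "d = 0 \<or> 8 \<le> d" "12 * d \<le> card P + 12 * n" for d
  proof (cases "12 * d \<le> card P")
    case True
    then have "three_way P d" using P d unfolding full_spectrum_def by blast
    then show ?thesis using three_way_Un[OF _ Q(4) dis fin Q(1)] by fastforce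
  next
    case False
    \<comment> \<open>Here \<open>d\<close> exceeds the at least 22 blocks of \<open>P\<close>, so
      \<open>d >= 23\<close>, while \<open>n <= 15\<close>.\<close>
    then have "8 \<le> d - n" "12 * (d - n) \<le> card P" "n \<le> d" using card Q(3) d by auto
    then have "three_way P (d - n)" using P unfolding full_spectrum_def by blast
    then show ?thesis using three_way_Un[OF _ Q(5) dis fin Q(1)] \<open>n \<le> d\<close> by fastforce
  qed
  then show ?thesis unfolding full_spectrum_def using fin Q(1) card un by simp
qed

lemma full_spectrum_UN:
  assumes "finite J" "full_spectrum P" and "\<And>j. j \<in> J \<Longrightarrow> finite (Q j)"
    and "\<And>j. j \<in> J \<Longrightarrow> \<exists>n\<le>15. card (Q j) = 12 * n \<and> three_way (Q j) 0 \<and> three_way (Q j) n"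
    and "\<And>i j. i \<in> J \<Longrightarrow> j \<in> J \<Longrightarrow> i \<noteq> j \<Longrightarrow> Q i \<inter> Q j = {}" and "\<And>j. j \<in> J \<Longrightarrow> P \<inter> Q j = {}"
  shows "full_spectrum (P \<union> (\<Union>j\<in>J. Q j))"
  using assms
proof (induction J rule: finite_induct)
  case (insert j J)
  have P: "full_spectrum (P \<union> (\<Union>j\<in>J. Q j))" using insert.IH insert.prems by blast
  obtain n where n: "n \<le> 15" "card (Q j) = 12 * n" "three_way (Q j) 0" "three_way (Q j) n"
    using insert.prems(3)[of j] by blast
  have fin: "finite (Q j)" using insert.prems(2)[of j] by simp
  have "(P \<union> (\<Union>j\<in>J. Q j)) \<inter> Q j = {}"
    using insert.prems(4,5) insert.hyps(2) by blast
  with full_spectrum_Un[OF P fin n(2,1,3,4)] have "full_spectrum ((P \<union> (\<Union>j\<in>J. Q j)) \<union> Q j)" .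
  then show ?case by (simp add: Un_ac)
qed simp

text \<open>\<open>G\<close> stands for the \<open>u\<close> copies of \<open>K\<close>(13), with 12
  times 13 arcs each, and \<open>Q\<close> for one \<open>K\<close>(3,3,3,3,3), with 12 times 15
  arcs. \<open>Q\<close> alone supplies the volumes 14 and 15 missing from \<open>G\<close>. Above
  \<open>13 * u\<close> it contributes 15, and \<open>u >= 4\<close> leaves at least 38 for
  \<open>G\<close>, clear of the gaps.\<close>

lemma full_spectrum_start:
  assumes G: "finite G" "card G = 156 * u" "u \<ge> 4"
    and G_three: "\<And>d. d \<le> 13 * u \<Longrightarrow> d = 0 \<or> 8 \<le> d \<and> d \<le> 13 \<or> 16 \<le> d \<Longrightarrow> three_way G d"
    and Q: "finite Q" "card Q = 180" "three_way Q 0" "three_way Q 14" "three_way Q 15" and dis: "G \<inter> Q = {}"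
  shows "full_spectrum (G \<union> Q)"
proof -
  have card: "card (G \<union> Q) = 156 * u + 180" using G Q dis by (simp add: card_Un_disjoint)
  have add: "three_way (G \<union> Q) (d + e)" if "three_way G d" "three_way Q e" for d e
    using three_way_Un[OF that dis G(1) Q(1)] .
  have "three_way (G \<union> Q) d" if d: "d = 0 \<or> 8 \<le> d" "12 * d \<le> 156 * u + 180" for d
  proof -
    consider "d = 14" | "d = 15" | "d \<le> 13 * u" "d \<noteq> 14" "d \<noteq> 15" | "13 * u < d" by linarith
    then show ?thesis
    proof cases
      case 1 then show ?thesis using add[OF G_three[of 0] Q(4)] by simp
    next
      case 2 then show ?thesis using add[OF G_three[of 0] Q(5)] by simp
    next
      case 3 then show ?thesis using add[OF G_three[of d] Q(3)] d by fastforce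
    next
      case 4
      then have "three_way G (d - 15)" using G(3) d by (intro G_three) auto
      then show ?thesis using add[OF _ Q(5), of "d - 15"] 4 G(3) by simp
    qed
  qed
  then show ?thesis unfolding full_spectrum_def card using G Q by simp
qed

lemma full_spectrum_arcs:
  assumes "GDD45_with5 u" "u \<ge> 4"
  obtains W :: "nat set" where "finite W" "card W = 12 * u + 1" "full_spectrum (arcs W)"
proof -
  obtain B b5 where B: "decomposes {4, 5} (multipartite {..<u} 4) B" and b5: "b5 \<in> B" "card b5 = 5"
    using assms(1) unfolding GDD45_with5_def by blast
  have finB: "finite B" by (rule decomposes_finite[OF B]) auto
  \<comment> \<open>\<open>None\<close> is the point at infinity and \<open>Some ((i, a), t)\<close>
    is copy \<open>t\<close> of the point \<open>a\<close> in group \<open>i\<close>. Different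
    graphs \<open>G i\<close> share only the vertex \<open>None\<close>, hence no arc.\<close>
  define G where "G i = arcs (insert None (Some ` (({i} \<times> {..<4::nat}) \<times> {..<3::nat})))" for i :: nat
  define Q where "Q b = map_prod Some Some ` multipartite b 3" for b :: "(nat \<times> nat) set"
  define V where "V = insert None (Some ` (({..<u} \<times> {..<4::nat}) \<times> {..<3::nat}))"
  have finQ: "finite (Q b)" if "b \<in> B" for b
    using decomposesD(1)[OF B that] unfolding Q_def by simp
  have cardQ: "card (Q b) = card b * (card b - 1) * 9" if "b \<in> B" for b
  proof -
    have "card (Q b) = card (multipartite b 3)" unfolding Q_def
      by (rule card_image) (auto simp: inj_on_def map_prod_def)
    then show ?thesis using decomposesD(1)[OF B that] by (simp add: card_multipartite)
  qed
  have Q_three: "three_way (Q b) d" if "b \<in> B" "three_way (multipartite {..<card b} 3) d" for b d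
  proof -
    have "three_way (multipartite b 3) d"
      using three_way_multipartite[OF that(2) decomposesD(1)[OF B that(1)] refl] .
    then show ?thesis unfolding Q_def by (rule three_way_image[where X = UNIV]) auto
  qed
  have mem_Q: "(Some (p, i), Some (q, j)) \<in> Q b \<longleftrightarrow> p \<in> b \<and> q \<in> b \<and> p \<noteq> q \<and> i < 3 \<and> j < 3" for p q i j b
    unfolding Q_def by (cases p, cases q) (auto simp: image_iff multipartite_def)
  have Q_Some: "\<exists>p i q j. e = (Some (p, i), Some (q, j))" if "e \<in> Q b" for e b
    using that unfolding Q_def multipartite_def by auto
  have QQ: "Q b \<inter> Q c = {}" if "b \<in> B" "c \<in> B" "b \<noteq> c" for b c
  proof -
    have False if e: "e \<in> Q b" "e \<in> Q c" for e
    proof -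
      obtain p i q j where "e = (Some (p, i), Some (q, j))" using Q_Some[OF e(1)] by blast
      with e have "p \<in> b" "q \<in> b" "p \<noteq> q" "p \<in> c" "q \<in> c" by (auto simp: mem_Q)
      then show False using decomposes_unique[OF B] that \<open>b \<in> B\<close> \<open>c \<in> B\<close> \<open>b \<noteq> c\<close> by blast
    qed
    then show ?thesis by blast
  qed
  have GQ: "G i \<inter> Q b = {}" if "b \<in> B" for i b
  proof -
    have False if e: "e \<in> G i" "e \<in> Q b" for e
    proof -
      obtain p t q t' where *: "e = (Some (p, t), Some (q, t'))" using Q_Some[OF e(2)] by blast
      with e have "p \<in> b" "q \<in> b" "p \<noteq> q" by (auto simp: mem_Q)
      then have "(p, q) \<in> multipartite {..<u} 4" using decomposesD(3)[OF B \<open>b \<in> B\<close>] by blast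
      then have "fst p \<noteq> fst q" by (cases p, cases q) auto
      moreover have "fst p = i" "fst q = i" using e(1) unfolding G_def * by auto
      ultimately show False by simp
    qed
    then show ?thesis by blast
  qed
  have GG: "G i \<inter> G j = {}" if "i \<noteq> j" for i j
    using that unfolding G_def arcs_def by auto
  have cardV: "card (insert None (Some ` ((I \<times> {..<4::nat}) \<times> {..<3::nat}))) = 12 * card I + 1"
    if "finite I" for I :: "nat set"
    using that by (subst card_insert_disjoint) (auto simp: card_image card_cartesian_product)
  have arcsV: "arcs V = ((\<Union>i<u. G i) \<union> Q b5) \<union> (\<Union>b\<in>B - {b5}. Q b)"
  proof -
    have "arcs V = (\<Union>i<u. G i) \<union> (\<Union>b\<in>B. Q b)"
    proof (intro subset_antisym subsetI)
      fix e assume e: "e \<in> arcs V"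
      show "e \<in> (\<Union>i<u. G i) \<union> (\<Union>b\<in>B. Q b)"
      \<comment> \<open>Two points over different groups lie over a unique block of the group
        divisible design. Every other pair, including copies of the same point and pairs with
        infinity, belongs to some \<open>G i\<close>.\<close>
      proof (cases "\<exists>i a t j b t'. e = (Some ((i, a), t), Some ((j, b), t')) \<and> i \<noteq> j")
        case True
        then obtain i a t j b t' where *: "e = (Some ((i, a), t), Some ((j, b), t'))" "i \<noteq> j" by blast
        then have "((i, a), (j, b)) \<in> multipartite {..<u} 4" "t < 3" "t' < 3"
          using e unfolding V_def by auto
        then have "\<exists>b'\<in>B. e \<in> Q b'"
          using decomposes_ex[OF B] unfolding * mem_Q by metis
        then show ?thesis by blast
      next
        case False
        obtain p q where pq: "e = (p, q)" by (cases e)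
        have mem: "(None, Some ((i, a), t)) \<in> G i \<and> (Some ((i, a), t), None) \<in> G i"
          if "a < 4" "t < 3" for i a t
          using that unfolding G_def by simp
        have "\<exists>i<u. e \<in> G i"
        proof (cases p)
          case None
          then obtain i a t where "q = Some ((i, a), t)" "i < u" "a < 4" "t < 3"
            using e unfolding pq V_def by auto
          then show ?thesis using mem None pq by blast
        next
          case (Some p')
          then obtain i a t where p: "p = Some ((i, a), t)" "i < u" "a < 4" "t < 3"
            using e unfolding pq V_def by auto
          show ?thesis
          proof (cases q)
            case None
            then show ?thesis using mem p pq by blast
          next
            case (Some q')
            then obtain j b t' where q: "q = Some ((j, b), t')" "b < 4" "t' < 3"
              using e unfolding pq V_def by auto
            then have "i = j" using False p pq by blast
            moreover have "p \<noteq> q" using e pq by simp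
            ultimately have "e \<in> G i" using p q unfolding pq G_def by simp
            then show ?thesis using p(2) by blast
          qed
        qed
        then show ?thesis by blast
      qed
    next
      fix e assume "e \<in> (\<Union>i<u. G i) \<union> (\<Union>b\<in>B. Q b)"
      then show "e \<in> arcs V"
      proof
        assume "e \<in> (\<Union>i<u. G i)"
        then show ?thesis unfolding G_def V_def by (cases e) auto
      next
        assume "e \<in> (\<Union>b\<in>B. Q b)"
        then obtain b where b: "b \<in> B" "e \<in> Q b" by blast
        then obtain p i q j where *: "e = (Some (p, i), Some (q, j))" using Q_Some by blast
        with b have "p \<in> b" "q \<in> b" "p \<noteq> q" "i < 3" "j < 3" by (auto simp: mem_Q)
        moreover have "(p, q) \<in> multipartite {..<u} 4"
          using decomposesD(3)[OF B b(1)] calculation by blast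
        ultimately show ?thesis unfolding V_def * by (cases p, cases q) auto
      qed
    qed
    moreover have "(\<Union>b\<in>B. Q b) = Q b5 \<union> (\<Union>b\<in>B - {b5}. Q b)"
      using b5(1) by (metis UN_insert insert_Diff)
    ultimately show ?thesis by (simp only: Un_assoc)
  qed
  have "full_spectrum ((\<Union>i<u. G i) \<union> Q b5)"
  proof (rule full_spectrum_start)
    have G13: "finite (insert None (Some ` (({i} \<times> {..<4::nat}) \<times> {..<3::nat})))"
        "card (insert None (Some ` (({i} \<times> {..<4::nat}) \<times> {..<3::nat}))) = 13" for i :: nat
      using cardV[of "{i}"] by auto
    show "finite (\<Union>i<u. G i)" unfolding G_def by simp
    have "card (\<Union>i<u. G i) = (\<Sum>i<u. card (G i))"
      using GG by (intro card_UN_disjoint) (auto simp: G_def)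
    also have "\<dots> = 156 * u" unfolding G_def card_arcs[OF G13(1)] G13(2) by simp
    finally show "card (\<Union>i<u. G i) = 156 * u" .
    show "three_way (\<Union>i<u. G i) d" if "d \<le> 13 * u" "d = 0 \<or> 8 \<le> d \<and> d \<le> 13 \<or> 16 \<le> d" for d
    proof (rule three_way_UN_13)
      show "three_way (G i) e" if "e = 0 \<or> 8 \<le> e \<and> e \<le> 13" for i e
        unfolding G_def using three_way_arcs_13[OF G13 that] .
    qed (use that GG in \<open>auto simp: G_def\<close>)
    show "finite (Q b5)" "card (Q b5) = 180" using finQ cardQ b5 by auto
    show "three_way (Q b5) 0" "three_way (Q b5) 14" "three_way (Q b5) 15"
      using Q_three[OF b5(1)] three_way_multipartite_5_3_14 three_way_multipartite_5_3_15
        three_way_zero b5(2) by metis+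
    show "(\<Union>i<u. G i) \<inter> Q b5 = {}" using GQ[OF b5(1)] by blast
  qed (rule assms(2))
  then have "full_spectrum (arcs V)" unfolding arcsV
  proof (rule full_spectrum_UN[rotated])
    fix b assume b: "b \<in> B - {b5}"
    have "card b = 4 \<or> card b = 5" using decomposesD(2)[OF B] b by auto
    then show "\<exists>n\<le>15. card (Q b) = 12 * n \<and> three_way (Q b) 0 \<and> three_way (Q b) n"
    proof
      assume *: "card b = 4"
      then have "three_way (Q b) 9" using Q_three b three_way_multipartite_4_3_9 by simp
      then show ?thesis using cardQ[of b] b * three_way_zero by (intro exI[of _ 9]) auto
    next
      assume *: "card b = 5"
      then have "three_way (Q b) 15" using Q_three b three_way_multipartite_5_3_15 by simp
      then show ?thesis using cardQ[of b] b * three_way_zero by (intro exI[of _ 15]) auto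
    qed
  next
    fix b assume "b \<in> B - {b5}"
    then show "((\<Union>i<u. G i) \<union> Q b5) \<inter> Q b = {}" using GQ[of b] QQ[of b5 b] b5(1) by blast
  qed (use finB finQ QQ in auto)
  moreover have "finite V" "card V = 12 * u + 1" using cardV[of "{..<u}"] unfolding V_def by auto
  moreover from this obtain g where g: "bij_betw g V {0..<12 * u + 1}"
    using ex_bij_betw_finite_nat[of V] by auto
  \<comment> \<open>The point set is moved to the natural numbers, over which \<open>J3\<close> is
    defined.\<close>
  have img: "map_prod g g ` arcs V = arcs {0..<12 * u + 1}"
    using arcs_image[of g V] g by (auto simp: bij_betw_def)
  have card_eq: "card (arcs {0..<12 * u + 1}) = card (arcs V)"
    using calculation by (simp add: card_arcs)
  have "three_way (arcs {0..<12 * u + 1}) d" if "three_way (arcs V) d" for d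
    using three_way_image[OF that, of V g] g unfolding img by (auto simp: arcs_def bij_betw_def)
  ultimately have "full_spectrum (arcs {0..<12 * u + 1})"
    unfolding full_spectrum_def card_eq by auto
  then show thesis using that[of "{0..<12 * u + 1}"] by simp
qed

section \<open>From volumes to intersection numbers\<close>

lemma S24_design_card:
  assumes "S24_design v V B"
  shows "finite B" "block_number v = int (card B)"
proof -
  have V: "finite V" "card V = v" and dec: "decomposes {4} (arcs V) B"
    using assms unfolding S24_design_iff_decomposes by auto
  show "finite B" using three_way_finite[OF dec] V(1) by simp
  have "v * (v - 1) = 12 * card B"
    using decomposes_card[OF dec] V by (simp add: card_arcs)
  then have "int (v * (v - 1)) = 12 * int (card B)" by simp
  moreover have "int (v * (v - 1)) = int v * (int v - 1)" by (cases v) (auto simp: algebra_simps)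
  ultimately show "block_number v = int (card B)" unfolding block_number_def by simp
qed

lemma J3_iff:
  "k \<in> J3 v \<longleftrightarrow> (\<exists>(V :: nat set) d. finite V \<and> card V = v \<and> three_way (arcs V) d \<and> k = block_number v - int d)"
proof
  assume "k \<in> J3 v"
  then obtain V :: "nat set" and B1 B2 B3 where B: "S24_design v V B1" "S24_design v V B2" "S24_design v V B3"
      "B1 \<inter> B2 = B1 \<inter> B3" "B1 \<inter> B3 = B2 \<inter> B3" "int (card (B1 \<inter> B2)) = k"
    unfolding J3_def by blast
  have "card (B1 \<inter> B2) + card (B1 - B2) = card B1"
    using card_Int_Diff[of B1 B2] S24_design_card(1)[OF B(1)] by simp
  then have "k = block_number v - int (card (B1 - B2))"
    using B(6) S24_design_card(2)[OF B(1)] by simp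
  moreover have "three_way (arcs V) (card (B1 - B2))"
  proof -
    have "decomposes {4} (arcs V) B" if "S24_design v V B" for B
      using that unfolding S24_design_iff_decomposes by blast
    from this[OF B(1)] this[OF B(2)] this[OF B(3)] B(4,5) show ?thesis
      unfolding three_way_def by (intro exI[of _ B1] exI[of _ B2] exI[of _ B3] conjI refl)
  qed
  moreover have "finite V" "card V = v" using B(1) unfolding S24_design_def by auto
  ultimately show "\<exists>(V :: nat set) d. finite V \<and> card V = v \<and> three_way (arcs V) d \<and> k = block_number v - int d"
    by blast
next
  assume "\<exists>(V :: nat set) d. finite V \<and> card V = v \<and> three_way (arcs V) d \<and> k = block_number v - int d"
  then obtain V :: "nat set" and B1 B2 B3 where V: "finite V" "card V = v"
      and B: "decomposes {4} (arcs V) B1" "decomposes {4} (arcs V) B2" "decomposes {4} (arcs V) B3"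
      "B1 \<inter> B2 = B1 \<inter> B3" "B1 \<inter> B3 = B2 \<inter> B3" and k: "k = block_number v - int (card (B1 - B2))"
    unfolding three_way_def by blast
  have des: "S24_design v V B" if "decomposes {4} (arcs V) B" for B
    using that V decomposes_subset[OF that, of V] unfolding S24_design_iff_decomposes
    by (auto simp: arcs_def)
  have "card (B1 \<inter> B2) + card (B1 - B2) = card B1"
    using card_Int_Diff[of B1 B2] S24_design_card(1)[OF des[OF B(1)]] by simp
  then have "int (card (B1 \<inter> B2)) = k" using k S24_design_card(2)[OF des[OF B(1)]] by simp
  then show "k \<in> J3 v" unfolding J3_def using des[OF B(1)] des[OF B(2)] des[OF B(3)] B(4,5) by blast
qed

theorem theorem5p2:
  fixes u v :: nat
  assumes "v > 0"
    and "v = 12 * u + 1"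
    and "[u = 2] (mod 4) \<or> [u = 3] (mod 4)"
    and "u \<ge> 7"
  shows "J3 v = I3 v"
proof (intro subset_antisym subsetI)
  fix k assume "k \<in> J3 v"
  then obtain V :: "nat set" and d where V: "finite V" "card V = v" and d: "three_way (arcs V) d"
      and k: "k = block_number v - int d"
    unfolding J3_iff by blast
  obtain B1 B2 where B: "decomposes {4} (arcs V) B1" "card (B1 - B2) = d"
    using d unfolding three_way_def by blast
  have design: "S24_design v V B1"
    using V B(1) decomposes_subset[OF B(1), of V] unfolding S24_design_iff_decomposes
    by (auto simp: arcs_def)
  then have "int d \<le> block_number v"
    using S24_design_card[OF design] B(2) card_mono[of B1 "B1 - B2"] by auto
  moreover have "d = 0 \<or> 8 \<le> d" using three_way_volume[OF d] V by simp
  ultimately show "k \<in> I3 v" unfolding I3_def k by auto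
next
  fix k assume k: "k \<in> I3 v"
  obtain W :: "nat set" where W: "finite W" "card W = v" "full_spectrum (arcs W)"
    using full_spectrum_arcs[OF GDD45_with5_exists, of u] assms by auto
  define d where "d = nat (block_number v - k)"
  \<comment> \<open>Volume 0 provides an actual design on \<open>W\<close>, which identifies
    \<open>card (arcs W)\<close> with 12 times \<open>block_number v\<close>; the bound in
    \<open>full_spectrum\<close> then reads \<open>d <= b_v\<close>.\<close>
  have "three_way (arcs W) 0" using W(3) unfolding full_spectrum_def by simp
  then obtain B where "decomposes {4} (arcs W) B" unfolding three_way_def by blast
  then have card: "card (arcs W) = 12 * card B" "S24_design v W B"
    using decomposes_card[of 4 "arcs W" B] W decomposes_subset[of "{4}" "arcs W" B W]
    unfolding S24_design_iff_decomposes by (auto simp: arcs_def)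
  have "k = block_number v - int d" "d = 0 \<or> 8 \<le> d" "int d \<le> block_number v"
    using k unfolding I3_def d_def by auto
  moreover from this have "three_way (arcs W) d"
    using W(3) card S24_design_card(2)[OF card(2)] unfolding full_spectrum_def by auto
  ultimately show "k \<in> J3 v" unfolding J3_iff using W(1,2) by blast
qed

end
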